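(* Let $\mathcal L$ contain a binary relation symbol $<$ and let $T$ be an $\mathcal L$-theory extending the theory of infinite linear orderings. If $T$ is weakly quasi-o-minimal, then $T$ has the $\mathrm{VC}1$ property.
   Context: $T$ is weakly quasi-o-minimal if in every model $\mathbf M$ of $T$, every definable (with parameters) subset of $M$ is a finite Boolean combination of convex subsets of $M$ and $\emptyset$-definable subsets of $M$. For a finite set $\Delta(x;y)$ of partitioned formulas, a uniform definition of $\Delta(x;B)$-types over finite sets in $\mathbf M$ with $d$ parameters is a finite family $(\mathcal F_i)_{i\in I}$, $\mathcal F_i=(\varphi_i(y;y_1,\dots,y_d))_{\varphi\in\Delta}$, $|y_j|=|y|$, such that for every finite $B\subseteq M^{|y|}$ and every $a\in M^{|x|}$ there are $b_1,\dots,b_d\in B$ and $i\in I$ with $\mathbf M\models\varphi(a;b)\iff\mathbf M\models\varphi_i(b;b_1,\dots,b_d)$ for all $\varphi\in\Delta,b\in B$. A structure has the $\mathrm{VC}d$ property if every finite nonempty $\Delta(x;y)$ with $|x|=1$ has such a definition with $d$ parameters; a theory has it if all its models do.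
   Formalization: In the definition of uniform definability of types, the finite set B is taken to be nonempty; for B empty no parameter b_1 in B exists, so the literal VC1 property would fail in every structure. *)

theory Defs
  imports Main "HOL-Library.Equipollence"
begin

section \<open>First-order logic with equality\<close>

record ('f, 'r) lang =
  fsyms :: "'f set"
  farity :: "'f \<Rightarrow> nat"
  rsyms :: "'r set"
  rarity :: "'r \<Rightarrow> nat"

datatype 'f tm = Var nat | Fn 'f "'f tm list"

datatype ('f, 'r) fm =
    Fls
  | Eql "'f tm" "'f tm"
  | Rel 'r "'f tm list"
  | Imp "('f, 'r) fm" "('f, 'r) fm"
  | Forall nat "('f, 'r) fm"

definition Neg :: "('f, 'r) fm \<Rightarrow> ('f, 'r) fm" where
  "Neg \<phi> = Imp \<phi> Fls"

definition Conj :: "('f, 'r) fm \<Rightarrow> ('f, 'r) fm \<Rightarrow> ('f, 'r) fm" where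
  "Conj \<phi> \<psi> = Neg (Imp \<phi> (Neg \<psi>))"

definition Disj :: "('f, 'r) fm \<Rightarrow> ('f, 'r) fm \<Rightarrow> ('f, 'r) fm" where
  "Disj \<phi> \<psi> = Imp (Neg \<phi>) \<psi>"

definition Exists :: "nat \<Rightarrow> ('f, 'r) fm \<Rightarrow> ('f, 'r) fm" where
  "Exists v \<phi> = Neg (Forall v (Neg \<phi>))"

fun is_term :: "('f, 'r) lang \<Rightarrow> 'f tm \<Rightarrow> bool" where
  "is_term L (Var v) \<longleftrightarrow> True"
| "is_term L (Fn f ts) \<longleftrightarrow>
     f \<in> fsyms L \<and> length ts = farity L f \<and> (\<forall>t \<in> set ts. is_term L t)"

fun is_formula :: "('f, 'r) lang \<Rightarrow> ('f, 'r) fm \<Rightarrow> bool" where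
  "is_formula L Fls \<longleftrightarrow> True"
| "is_formula L (Eql s t) \<longleftrightarrow> is_term L s \<and> is_term L t"
| "is_formula L (Rel r ts) \<longleftrightarrow>
     r \<in> rsyms L \<and> length ts = rarity L r \<and> (\<forall>t \<in> set ts. is_term L t)"
| "is_formula L (Imp \<phi> \<psi>) \<longleftrightarrow> is_formula L \<phi> \<and> is_formula L \<psi>"
| "is_formula L (Forall v \<phi>) \<longleftrightarrow> is_formula L \<phi>"

fun tvars :: "'f tm \<Rightarrow> nat set" where
  "tvars (Var v) = {v}"
| "tvars (Fn f ts) = (\<Union>t \<in> set ts. tvars t)"

fun fvars :: "('f, 'r) fm \<Rightarrow> nat set" where
  "fvars Fls = {}"
| "fvars (Eql s t) = tvars s \<union> tvars t"
| "fvars (Rel r ts) = (\<Union>t \<in> set ts. tvars t)"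
| "fvars (Imp \<phi> \<psi>) = fvars \<phi> \<union> fvars \<psi>"
| "fvars (Forall v \<phi>) = fvars \<phi> - {v}"

definition is_theory :: "('f, 'r) lang \<Rightarrow> ('f, 'r) fm set \<Rightarrow> bool" where
  "is_theory L T \<longleftrightarrow> (\<forall>\<sigma> \<in> T. is_formula L \<sigma> \<and> fvars \<sigma> = {})"

record ('f, 'r, 'u) struct =
  carrier :: "'u set"
  fint :: "'f \<Rightarrow> 'u list \<Rightarrow> 'u"
  rint :: "'r \<Rightarrow> 'u list \<Rightarrow> bool"

definition is_structure :: "('f, 'r) lang \<Rightarrow> ('f, 'r, 'u) struct \<Rightarrow> bool" where
  "is_structure L M \<longleftrightarrow> carrier M \<noteq> {} \<and>
     (\<forall>f \<in> fsyms L. \<forall>as. length as = farity L f \<and> set as \<subseteq> carrier M \<longrightarrow> fint M f as \<in> carrier M)"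

fun eval :: "('f, 'r, 'u) struct \<Rightarrow> (nat \<Rightarrow> 'u) \<Rightarrow> 'f tm \<Rightarrow> 'u" where
  "eval M e (Var v) = e v"
| "eval M e (Fn f ts) = fint M f (map (eval M e) ts)"

fun sat :: "('f, 'r, 'u) struct \<Rightarrow> (nat \<Rightarrow> 'u) \<Rightarrow> ('f, 'r) fm \<Rightarrow> bool" where
  "sat M e Fls \<longleftrightarrow> False"
| "sat M e (Eql s t) \<longleftrightarrow> eval M e s = eval M e t"
| "sat M e (Rel r ts) \<longleftrightarrow> rint M r (map (eval M e) ts)"
| "sat M e (Imp \<phi> \<psi>) \<longleftrightarrow> (sat M e \<phi> \<longrightarrow> sat M e \<psi>)"
| "sat M e (Forall v \<phi>) \<longleftrightarrow> (\<forall>a \<in> carrier M. sat M (e(v := a)) \<phi>)"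

definition valid_in :: "('f, 'r, 'u) struct \<Rightarrow> ('f, 'r) fm \<Rightarrow> bool" where
  "valid_in M \<sigma> \<longleftrightarrow> (\<forall>e. range e \<subseteq> carrier M \<longrightarrow> sat M e \<sigma>)"

definition is_model :: "('f, 'r) lang \<Rightarrow> ('f, 'r) fm set \<Rightarrow> ('f, 'r, 'u) struct \<Rightarrow> bool" where
  "is_model L T M \<longleftrightarrow> is_structure L M \<and> (\<forall>\<sigma> \<in> T. valid_in M \<sigma>)"

text \<open>
  HOL cannot quantify over all types inside a formula, so notions that speak about ``all models''
  of a theory take a type argument and range over the models whose carrier is a subset of
  that type, that is, up to isomorphism, over all models of at most that cardinality. As
  soon as the type has at least as many elements as there are formulas of the language, the
  downward Loewenheim-Skolem theorem makes this independent of the type.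
\<close>

definition large_universe :: "'u itself \<Rightarrow> ('f, 'r) lang \<Rightarrow> bool" where
  "large_universe U L \<longleftrightarrow> {\<phi>. is_formula L \<phi>} \<lesssim> (UNIV :: 'u set)"

definition entails ::
    "'u itself \<Rightarrow> ('f, 'r) lang \<Rightarrow> ('f, 'r) fm set \<Rightarrow> ('f, 'r) fm \<Rightarrow> bool" where
  "entails U L T \<sigma> \<longleftrightarrow> (\<forall>M :: ('f, 'r, 'u) struct. is_model L T M \<longrightarrow> valid_in M \<sigma>)"

definition extends ::
    "'u itself \<Rightarrow> ('f, 'r) lang \<Rightarrow> ('f, 'r) fm set \<Rightarrow> ('f, 'r) fm set \<Rightarrow> bool" where
  "extends U L T T' \<longleftrightarrow> (\<forall>\<sigma> \<in> T'. entails U L T \<sigma>)"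

section \<open>Infinite linear orderings\<close>

definition Less :: "'r \<Rightarrow> nat \<Rightarrow> nat \<Rightarrow> ('f, 'r) fm" where
  "Less lt v w = Rel lt [Var v, Var w]"

definition at_least :: "nat \<Rightarrow> ('f, 'r) fm" where
  "at_least n = foldr Exists [0..<n]
     (foldr Conj [Neg (Eql (Var i) (Var j)). j \<leftarrow> [0..<n], i \<leftarrow> [0..<j]] (Neg Fls))"

definition infinite_linear_orderings :: "'r \<Rightarrow> ('f, 'r) fm set" where
  "infinite_linear_orderings lt =
     {Forall 0 (Neg (Less lt 0 0)),
      Forall 0 (Forall 1 (Forall 2 (Imp (Less lt 0 1) (Imp (Less lt 1 2) (Less lt 0 2))))),
      Forall 0 (Forall 1 (Disj (Less lt 0 1) (Disj (Eql (Var 0) (Var 1)) (Less lt 1 0))))}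
     \<union> range at_least"

section \<open>Weak quasi-o-minimality\<close>

text \<open>The value at variables outside \<open>vs\<close> is irrelevant: \<open>assign\<close> is only used for formulas whose
  free variables all lie in \<open>vs\<close>.\<close>

definition assign :: "nat list \<Rightarrow> 'u list \<Rightarrow> nat \<Rightarrow> 'u" where
  "assign vs as v = the (map_of (zip vs as) v)"

definition definable_over ::
    "('f, 'r) lang \<Rightarrow> ('f, 'r, 'u) struct \<Rightarrow> 'u set \<Rightarrow> 'u set \<Rightarrow> bool" where
  "definable_over L M A D \<longleftrightarrow>
     (\<exists>\<phi> x ys bs. is_formula L \<phi> \<and> distinct (x # ys) \<and> fvars \<phi> \<subseteq> set (x # ys) \<and>
        length bs = length ys \<and> set bs \<subseteq> A \<and>
        D = {a \<in> carrier M. sat M (assign (x # ys) (a # bs)) \<phi>})"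

definition convex_in :: "'r \<Rightarrow> ('f, 'r, 'u) struct \<Rightarrow> 'u set \<Rightarrow> bool" where
  "convex_in lt M C \<longleftrightarrow> C \<subseteq> carrier M \<and>
     (\<forall>a \<in> C. \<forall>b \<in> C. \<forall>c \<in> carrier M. rint M lt [a, c] \<and> rint M lt [c, b] \<longrightarrow> c \<in> C)"

inductive_set boolean_combinations :: "'u set \<Rightarrow> 'u set set \<Rightarrow> 'u set set"
  for X :: "'u set" and G :: "'u set set" where
  gen: "S \<in> G \<Longrightarrow> S \<in> boolean_combinations X G"
| compl: "S \<in> boolean_combinations X G \<Longrightarrow> X - S \<in> boolean_combinations X G"
| union: "S \<in> boolean_combinations X G \<Longrightarrow> S' \<in> boolean_combinations X G \<Longrightarrow>
    S \<union> S' \<in> boolean_combinations X G"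
| inter: "S \<in> boolean_combinations X G \<Longrightarrow> S' \<in> boolean_combinations X G \<Longrightarrow>
    S \<inter> S' \<in> boolean_combinations X G"

definition weakly_quasi_o_minimal ::
    "'u itself \<Rightarrow> ('f, 'r) lang \<Rightarrow> 'r \<Rightarrow> ('f, 'r) fm set \<Rightarrow> bool" where
  "weakly_quasi_o_minimal U L lt T \<longleftrightarrow>
     (\<forall>M :: ('f, 'r, 'u) struct. is_model L T M \<longrightarrow>
        (\<forall>D. definable_over L M (carrier M) D \<longrightarrow>
           D \<in> boolean_combinations (carrier M)
                 ({C. convex_in lt M C} \<union> {E. definable_over L M {} E})))"

section \<open>The VC d property\<close>

definition partitioned_formulas ::
    "('f, 'r) lang \<Rightarrow> nat list \<Rightarrow> nat list \<Rightarrow> ('f, 'r) fm set \<Rightarrow> bool" where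
  "partitioned_formulas L xs ys \<Delta> \<longleftrightarrow> distinct (xs @ ys) \<and>
     (\<forall>\<phi> \<in> \<Delta>. is_formula L \<phi> \<and> fvars \<phi> \<subseteq> set (xs @ ys))"

text \<open>
  \<open>zss\<close> is the list of the parameter tuples \<open>y\<^sub>1, \<dots>, y\<^sub>d\<close>, and \<open>F i \<phi>\<close> is the formula
  \<open>\<phi>\<^sub>i(y; y\<^sub>1, \<dots>, y\<^sub>d)\<close>. The set \<open>B\<close> must be nonempty: for \<open>d \<ge> 1\<close> no parameters can be chosen
  from the empty set.
\<close>

definition uniform_definition ::
    "('f, 'r) lang \<Rightarrow> ('f, 'r, 'u) struct \<Rightarrow> nat list \<Rightarrow> nat list \<Rightarrow> ('f, 'r) fm set \<Rightarrow> nat \<Rightarrow>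
     nat list list \<Rightarrow> nat set \<Rightarrow> (nat \<Rightarrow> ('f, 'r) fm \<Rightarrow> ('f, 'r) fm) \<Rightarrow> bool" where
  "uniform_definition L M xs ys \<Delta> d zss I F \<longleftrightarrow>
     length zss = d \<and> (\<forall>zs \<in> set zss. length zs = length ys) \<and> distinct (ys @ concat zss) \<and>
     finite I \<and>
     (\<forall>i \<in> I. \<forall>\<phi> \<in> \<Delta>. is_formula L (F i \<phi>) \<and> fvars (F i \<phi>) \<subseteq> set (ys @ concat zss)) \<and>
     (\<forall>B a. finite B \<and> B \<noteq> {} \<and> (\<forall>b \<in> B. length b = length ys \<and> set b \<subseteq> carrier M) \<and>
            length a = length xs \<and> set a \<subseteq> carrier M \<longrightarrow>
        (\<exists>bs. length bs = d \<and> set bs \<subseteq> B \<and>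
          (\<exists>i \<in> I. \<forall>\<phi> \<in> \<Delta>. \<forall>b \<in> B.
             sat M (assign (xs @ ys) (a @ b)) \<phi> \<longleftrightarrow>
             sat M (assign (ys @ concat zss) (b @ concat bs)) (F i \<phi>))))"

definition structure_VC_property ::
    "('f, 'r) lang \<Rightarrow> ('f, 'r, 'u) struct \<Rightarrow> nat \<Rightarrow> bool" where
  "structure_VC_property L M d \<longleftrightarrow>
     (\<forall>xs ys \<Delta>. partitioned_formulas L xs ys \<Delta> \<and> finite \<Delta> \<and> \<Delta> \<noteq> {} \<and> length xs = 1 \<longrightarrow>
        (\<exists>zss I F. uniform_definition L M xs ys \<Delta> d zss I F))"

definition theory_VC_property ::
    "'u itself \<Rightarrow> ('f, 'r) lang \<Rightarrow> ('f, 'r) fm set \<Rightarrow> nat \<Rightarrow> bool" where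
  "theory_VC_property U L T d \<longleftrightarrow>
     (\<forall>M :: ('f, 'r, 'u) struct. is_model L T M \<longrightarrow> structure_VC_property L M d)"

end

theory Submission
  imports Defs
begin

text \<open>
  By compactness and weak quasi-o-minimality, for each \<open>\<phi>(x; y)\<close> there are finitely many formulas
  \<open>\<Theta>(x)\<close> without parameters and a bound \<open>n\<close> such that on no realisation set \<open>K\<close> of a complete
  \<open>\<Theta>\<close>-type does \<open>\<phi>(x; b)\<close> change its truth value more than \<open>n\<close> times along the order. Hence on \<open>K\<close>
  it is a Boolean combination of the initial segments ``fewer than \<open>k\<close> alternations of \<open>\<phi>(x; b)\<close>
  have occurred up to \<open>x\<close>'', which are uniformly definable from \<open>b\<close>. Initial segments form a chain under
  inclusion. So among the finitely many that come from \<open>B\<close> and contain \<open>a\<close> there is a least one, say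
  with parameter \<open>b\<^sub>0\<close>, and \<open>a\<close> lies in another one iff that one includes the least one: the parameter
  \<open>b\<^sub>0\<close> and the \<open>\<Theta>\<close>-type of \<open>a\<close> determine everything.
\<close>

section \<open>Syntax and semantics\<close>

text \<open>Two obstacles shape the proof. The hypotheses speak of models in the universe
  \<open>'u\<close>, the conclusion of models in \<open>'v\<close>, and no relation between the two
  cardinalities is assumed. So compactness has to turn finite satisfiability in \<open>'v\<close>
  into a model in \<open>'u\<close>, with downward Loewenheim-Skolem built in; this is why the new
  model consists of classes of Skolem codes, not of all functions on the index set. Secondly, weak
  quasi-o-minimality decomposes one set in one model at a time, by convex sets that need not be
  definable, so the size of the decomposition is not itself a first-order matter. The number of
  alternations is, and every decomposition bounds it: a convex set is the difference of two initial
  segments, and an increasing chain leaves each initial segment at most once. If no pair of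
  \<open>\<Theta>\<close> and \<open>n\<close> worked, a new free variable \<open>w\<close> would
  select one type for all \<open>\<Theta>\<close> simultaneously, and compactness would give a
  single model in which alternations are unbounded on the type of \<open>w\<close> for every
  \<open>\<Theta>\<close>, against its decomposition.\<close>

lemma sat_connectives [simp]:
  "sat M e (Neg \<phi>) \<longleftrightarrow> \<not> sat M e \<phi>"
  "sat M e (Conj \<phi> \<psi>) \<longleftrightarrow> sat M e \<phi> \<and> sat M e \<psi>"
  "sat M e (Disj \<phi> \<psi>) \<longleftrightarrow> sat M e \<phi> \<or> sat M e \<psi>"
  "sat M e (Exists v \<phi>) \<longleftrightarrow> (\<exists>a \<in> carrier M. sat M (e(v := a)) \<phi>)"
  by (auto simp: Neg_def Conj_def Disj_def Exists_def)

lemma is_formula_connectives [simp]: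
  "is_formula L (Neg \<phi>) \<longleftrightarrow> is_formula L \<phi>"
  "is_formula L (Conj \<phi> \<psi>) \<longleftrightarrow> is_formula L \<phi> \<and> is_formula L \<psi>"
  "is_formula L (Disj \<phi> \<psi>) \<longleftrightarrow> is_formula L \<phi> \<and> is_formula L \<psi>"
  "is_formula L (Exists v \<phi>) \<longleftrightarrow> is_formula L \<phi>"
  by (auto simp: Neg_def Conj_def Disj_def Exists_def)

lemma fvars_connectives [simp]:
  "fvars (Neg \<phi>) = fvars \<phi>"
  "fvars (Conj \<phi> \<psi>) = fvars \<phi> \<union> fvars \<psi>"
  "fvars (Disj \<phi> \<psi>) = fvars \<phi> \<union> fvars \<psi>"
  "fvars (Exists v \<phi>) = fvars \<phi> - {v}"
  by (auto simp: Neg_def Conj_def Disj_def Exists_def)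

lemma eval_cong: "(\<And>v. v \<in> tvars t \<Longrightarrow> e v = e' v) \<Longrightarrow> eval M e t = eval M e' t"
proof (induction t)
  case (Fn f ts)
  then have "map (eval M e) ts = map (eval M e') ts"
    by (fastforce intro: map_cong)
  then show ?case by (simp only: eval.simps)
qed simp

lemma sat_cong: "(\<And>v. v \<in> fvars \<phi> \<Longrightarrow> e v = e' v) \<Longrightarrow> sat M e \<phi> = sat M e' \<phi>"
proof (induction \<phi> arbitrary: e e')
  case (Eql s t)
  then have "eval M e s = eval M e' s" "eval M e t = eval M e' t"
    by (auto intro: eval_cong)
  then show ?case by simp
next
  case (Rel r ts)
  then have "map (eval M e) ts = map (eval M e') ts"
    by (fastforce intro: map_cong eval_cong)
  then show ?case by (simp only: sat.simps)
next
  case (Imp \<phi> \<psi>)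
  have "sat M e \<phi> = sat M e' \<phi>"
    by (rule Imp.IH(1)) (simp add: Imp.prems)
  moreover have "sat M e \<psi> = sat M e' \<psi>"
    by (rule Imp.IH(2)) (simp add: Imp.prems)
  ultimately show ?case by simp
next
  case (Forall v \<phi>)
  have "sat M (e(v := a)) \<phi> = sat M (e'(v := a)) \<phi>" for a
    by (rule Forall.IH) (use Forall.prems in auto)
  then show ?case by simp
qed simp

lemma finite_tvars: "finite (tvars t)"
  by (induction t) auto

lemma finite_fvars: "finite (fvars \<phi>)"
  by (induction \<phi>) (auto simp: finite_tvars)

lemma assign_Cons [simp]: "assign (x # xs) (a # as) = (assign xs as)(x := a)"
  by (auto simp: assign_def)

lemma assign_append:
  assumes "length as = length xs"
  shows "assign (xs @ ys) (as @ bs) v = (if v \<in> set xs then assign xs as v else assign ys bs v)"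
  using assms by (induction as xs rule: list_induct2) auto

lemma assign_map: "v \<in> set ys \<Longrightarrow> assign ys (map e ys) v = e v"
  by (induction ys) auto

lemma map_assign: "length ys = length bs \<Longrightarrow> distinct ys \<Longrightarrow> map (assign ys bs) ys = bs"
  by (induction ys bs rule: list_induct2) (auto simp: map_fun_upd)

section \<open>Compactness\<close>

text \<open>Zorn's lemma gives a minimal proper filter below \<open>F\<close>: the infimum of a
  nonempty chain is proper because the chain is a filter base. Minimality decides each
  \<open>P\<close>, since the infimum of \<open>U\<close> with the principal filter of
  \<open>P\<close> is either \<open>bot\<close> or \<open>U\<close> itself.\<close>

lemma ultrafilter_exists:
  assumes "F \<noteq> bot"
  obtains U :: "'a filter" where "U \<le> F" "U \<noteq> bot"
    "\<And>P. eventually P U \<or> eventually (\<lambda>x. \<not> P x) U"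
proof -
  let ?R = "\<lambda>G H :: 'a filter. H \<le> G"
  let ?A = "{G. G \<noteq> bot \<and> G \<le> F}"
  have "\<exists>U\<in>?A. \<forall>G\<in>?A. G \<le> U \<longrightarrow> G = U"
  proof (rule predicate_Zorn)
    show "partial_order_on ?A (relation_of ?R ?A)"
      by (rule partial_order_on_relation_ofI) auto
    fix C assume C: "C \<in> Chains (relation_of ?R ?A)"
    then have CA: "C \<subseteq> ?A" and lin: "\<And>G H. G \<in> C \<Longrightarrow> H \<in> C \<Longrightarrow> G \<le> H \<or> H \<le> G"
      by (auto simp: Chains_def relation_of_def)
    show "\<exists>U\<in>?A. \<forall>G\<in>C. U \<le> G"
    proof (cases "C = {}")
      case True
      then show ?thesis using assms by auto
    next
      case False
      have "Inf C \<noteq> bot"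
      proof
        assume "Inf C = bot"
        then have "eventually (\<lambda>_. False) (Inf C)" by simp
        moreover have "\<exists>x\<in>C. x \<le> inf G H" if "G \<in> C" "H \<in> C" for G H
          using lin[OF that] that by (metis inf.orderE inf.absorb2 order_refl)
        ultimately obtain G where "G \<in> C" "eventually (\<lambda>_. False) G"
          using eventually_Inf_base[OF False] by blast
        then show False using CA by (auto simp: eventually_False)
      qed
      moreover obtain G where "G \<in> C" using False by auto
      then have "Inf C \<le> F" using CA by (intro Inf_lower2[of G]) auto
      ultimately show ?thesis by (auto intro!: bexI[of _ "Inf C"] Inf_lower)
    qed
  qed
  then obtain U where U: "U \<noteq> bot" "U \<le> F"
    and max: "\<And>G. G \<noteq> bot \<Longrightarrow> G \<le> F \<Longrightarrow> G \<le> U \<Longrightarrow> G = U" by auto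
  show thesis
  proof (rule that[OF U(2,1)])
    fix P
    show "eventually P U \<or> eventually (\<lambda>x. \<not> P x) U"
    proof (cases "inf U (principal {x. P x}) = bot")
      case True
      then have "eventually (\<lambda>_. False) (inf U (principal {x. P x}))" by simp
      then show ?thesis by (simp add: eventually_inf_principal)
    next
      case False
      then have "inf U (principal {x. P x}) = U"
        using U by (intro max) (auto intro: le_infI1)
      moreover have "eventually P (inf U (principal {x. P x}))"
        by (simp add: eventually_inf_principal)
      ultimately show ?thesis by simp
    qed
  qed
qed

section \<open>Skolem functions and their codes\<close>

text \<open>\<open>Forall\<close> is the primitive quantifier, so the Skolem function returns a
  counterexample instead of a witness. The default \<open>d\<close> keeps its values in the carrier
  when there is none.\<close>

definition skolem_witness ::
    "('f, 'r, 'u) struct \<Rightarrow> 'u \<Rightarrow> (nat \<Rightarrow> 'u) \<Rightarrow> ('f, 'r) fm \<Rightarrow> 'u" where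
  "skolem_witness M d e \<chi> = (case \<chi> of
     Forall v \<phi> \<Rightarrow>
       if \<exists>a \<in> carrier M. \<not> sat M (e(v := a)) \<phi>
       then SOME a. a \<in> carrier M \<and> \<not> sat M (e(v := a)) \<phi> else d
   | _ \<Rightarrow> d)"

lemma skolem_witness_in_carrier: "d \<in> carrier M \<Longrightarrow> skolem_witness M d e \<chi> \<in> carrier M"
  unfolding skolem_witness_def
  using someI_ex[of "\<lambda>a. a \<in> carrier M \<and> \<not> sat M (e(v := a)) \<phi>" for v \<phi>]
  by (cases \<chi>) auto

lemma skolem_witness_refutes:
  assumes "a \<in> carrier M" "\<not> sat M (e(v := a)) \<phi>"
  shows "\<not> sat M (e(v := skolem_witness M d e (Forall v \<phi>))) \<phi>"
  using assms someI_ex[of "\<lambda>a. a \<in> carrier M \<and> \<not> sat M (e(v := a)) \<phi>"]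
  by (auto simp: skolem_witness_def)

text \<open>
  Skolem terms are coded by formulas, so that there are automatically no more of them than there are
  formulas: \<open>Imp\<close> serves as a pairing function, \<open>Imp \<chi> \<psi>\<close> stands for the Skolem function of
  \<open>\<chi>\<close> applied to the list coded by \<open>\<psi>\<close>, and \<open>Eql (Var n) (Var n)\<close> stands for the variable \<open>n\<close>.
\<close>

fun code_value :: "('f, 'r, 'u) struct \<Rightarrow> (nat \<Rightarrow> 'u) \<Rightarrow> ('f, 'r) fm \<Rightarrow> 'u"
  and code_values :: "('f, 'r, 'u) struct \<Rightarrow> (nat \<Rightarrow> 'u) \<Rightarrow> ('f, 'r) fm \<Rightarrow> 'u list" where
  "code_value M e (Imp \<chi> \<psi>) =
     skolem_witness M (e 0) (\<lambda>n. let as = code_values M e \<psi> in if n < length as then as ! n else e 0) \<chi>"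
| "code_value M e (Eql (Var n) t) = e n"
| "code_value M e _ = e 0"
| "code_values M e (Imp \<phi> \<psi>) = code_value M e \<phi> # code_values M e \<psi>"
| "code_values M e _ = []"

definition list_code :: "('f, 'r) fm list \<Rightarrow> ('f, 'r) fm" where
  "list_code cs = foldr Imp cs Fls"

lemma code_values_list_code: "code_values M e (list_code cs) = map (code_value M e) cs"
  by (induction cs) (auto simp: list_code_def)

lemma is_formula_list_code: "is_formula L (list_code cs) \<longleftrightarrow> (\<forall>c \<in> set cs. is_formula L c)"
  by (induction cs) (auto simp: list_code_def)

lemma code_value_in_carrier: "range e \<subseteq> carrier M \<Longrightarrow> code_value M e c \<in> carrier M"
  by (cases "(M, e, c)" rule: code_value.cases) (auto intro!: skolem_witness_in_carrier)

text \<open>This is the Skolem function of the formula saying that no element equals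
  \<open>f\<close> of the arguments, whose only counterexample is the value of \<open>f\<close>.
  Hence closure under Skolem functions already yields closure under the function symbols, and codes
  have no separate constructor for them.\<close>

definition fun_code :: "'f \<Rightarrow> ('f, 'r) fm list \<Rightarrow> ('f, 'r) fm" where
  "fun_code f cs = Imp (Forall (length cs)
     (Neg (Eql (Var (length cs)) (Fn f (map Var [0..<length cs]))))) (list_code cs)"

lemma is_formula_fun_code:
  assumes "f \<in> fsyms L" "length cs = farity L f" "\<And>c. c \<in> set cs \<Longrightarrow> is_formula L c"
  shows "is_formula L (fun_code f cs)"
  using assms by (simp add: fun_code_def is_formula_list_code)

lemma code_value_fun_code:
  fixes cs :: "('f, 'r) fm list"
  assumes "is_structure L M" "range e \<subseteq> carrier M" "f \<in> fsyms L" "length cs = farity L f"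
  shows "code_value M e (fun_code f cs) = fint M f (map (code_value M e) cs)"
proof -
  define E where "E n = (if n < length cs then map (code_value M e) cs ! n else e 0)" for n
  define \<phi> :: "('f, 'r) fm" where
    "\<phi> = Neg (Eql (Var (length cs)) (Fn f (map Var [0..<length cs])))"
  have args: "map (eval M (E(length cs := a))) (map Var [0..<length cs]) = map (code_value M e) cs" for a
    by (rule nth_equalityI) (auto simp: E_def)
  have sat: "sat M (E(length cs := a)) \<phi> \<longleftrightarrow> a \<noteq> fint M f (map (code_value M e) cs)" for a
    unfolding \<phi>_def using args[of a] by (simp del: map_map)
  have "fint M f (map (code_value M e) cs) \<in> carrier M"
    using assms code_value_in_carrier[OF assms(2)] by (simp add: is_structure_def image_subset_iff)
  then have "\<not> sat M (E(length cs := skolem_witness M (e 0) E (Forall (length cs) \<phi>))) \<phi>"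
    using sat by (intro skolem_witness_refutes) auto
  moreover have "code_value M e (fun_code f cs) = skolem_witness M (e 0) E (Forall (length cs) \<phi>)"
    by (simp add: fun_code_def code_values_list_code \<phi>_def E_def[abs_def] Let_def cong: if_cong)
  ultimately show ?thesis using sat by simp
qed

text \<open>The index set is the type of all pairs of a structure and an assignment, so that each
  index is its own interpretation and a code denotes the function sending an index to its value
  there. The injection \<open>g\<close> places codes in the target universe.\<close>

locale skolem_ultraproduct =
  fixes L :: "('f, 'r) lang" and U :: "(('f, 'r, 'v) struct \<times> (nat \<Rightarrow> 'v)) filter"
    and g :: "('f, 'r) fm \<Rightarrow> 'u"
  assumes proper: "U \<noteq> bot"
    and ultra: "eventually P U \<or> eventually (\<lambda>p. \<not> P p) U"
    and structures: "\<forall>\<^sub>F p in U. is_structure L (fst p) \<and> range (snd p) \<subseteq> carrier (fst p)"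
    and inj: "inj_on g {\<phi>. is_formula L \<phi>}"
begin

section \<open>The ultraproduct of codes and Los's theorem\<close>

lemma eventually_not_iff: "eventually (\<lambda>p. \<not> P p) U \<longleftrightarrow> \<not> eventually P U"
proof
  assume "eventually (\<lambda>p. \<not> P p) U"
  show "\<not> eventually P U"
  proof
    assume "eventually P U"
    with \<open>eventually (\<lambda>p. \<not> P p) U\<close> have "eventually (\<lambda>_. False) U"
      by eventually_elim simp
    with proper show False by (simp add: eventually_False)
  qed
qed (use ultra in blast)

lemma eventually_imp_iff:
  "eventually (\<lambda>p. P p \<longrightarrow> Q p) U \<longleftrightarrow> (eventually P U \<longrightarrow> eventually Q U)"
proof
  show "eventually (\<lambda>p. P p \<longrightarrow> Q p) U \<Longrightarrow> eventually P U \<longrightarrow> eventually Q U"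
    by (auto elim: eventually_mp)
next
  assume "eventually P U \<longrightarrow> eventually Q U"
  then have "eventually (\<lambda>p. \<not> P p) U \<or> eventually Q U"
    using eventually_not_iff by blast
  then show "eventually (\<lambda>p. P p \<longrightarrow> Q p) U"
    by (auto elim: eventually_mono)
qed

definition val :: "('f, 'r) fm \<Rightarrow> ('f, 'r, 'v) struct \<times> (nat \<Rightarrow> 'v) \<Rightarrow> 'v" where
  "val c p = code_value (fst p) (snd p) c"

definition eqv :: "('f, 'r) fm \<Rightarrow> ('f, 'r) fm \<Rightarrow> bool" where
  "eqv c c' \<longleftrightarrow> (\<forall>\<^sub>F p in U. val c p = val c' p)"

text \<open>The chosen representative depends only on the class, since \<open>eqv\<close> is an
  equivalence; it is required to be a formula of \<open>L\<close> because \<open>g\<close> is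
  injective only there.\<close>

definition cls :: "('f, 'r) fm \<Rightarrow> 'u" where
  "cls c = g (SOME c'. is_formula L c' \<and> eqv c' c)"

definition code_of :: "'u \<Rightarrow> ('f, 'r) fm" where
  "code_of u = (SOME c. is_formula L c \<and> cls c = u)"

definition ultraprod :: "('f, 'r, 'u) struct" where
  "ultraprod = \<lparr>carrier = cls ` {c. is_formula L c},
     fint = (\<lambda>f us. cls (fun_code f (map code_of us))),
     rint = (\<lambda>r us. \<forall>\<^sub>F p in U. rint (fst p) r (map (\<lambda>u. val (code_of u) p) us))\<rparr>"

lemma ultraprod_simps:
  "carrier ultraprod = cls ` {c. is_formula L c}"
  "fint ultraprod f us = cls (fun_code f (map code_of us))"
  "rint ultraprod r us \<longleftrightarrow> (\<forall>\<^sub>F p in U. rint (fst p) r (map (\<lambda>u. val (code_of u) p) us))"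
  by (simp_all add: ultraprod_def)

lemma eqv_refl [simp]: "eqv c c"
  by (simp add: eqv_def)

lemma eqv_sym: "eqv c c' \<Longrightarrow> eqv c' c"
  unfolding eqv_def by (erule eventually_mono) simp

lemma eqv_trans: "eqv c c' \<Longrightarrow> eqv c' c'' \<Longrightarrow> eqv c c''"
  unfolding eqv_def by (erule (1) eventually_elim2) simp

lemma cls_eq_iff:
  assumes "is_formula L c" "is_formula L c'"
  shows "cls c = cls c' \<longleftrightarrow> eqv c c'"
proof
  let ?rep = "\<lambda>c. SOME c'. is_formula L c' \<and> eqv c' c"
  have rep: "is_formula L (?rep c) \<and> eqv (?rep c) c" if "is_formula L c" for c
    by (rule someI[of _ c]) (simp add: that)
  assume "cls c = cls c'"
  then have "?rep c = ?rep c'"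
    using rep assms inj unfolding cls_def by (auto dest: inj_onD)
  then show "eqv c c'"
    using rep[OF assms(1)] rep[OF assms(2)] eqv_sym eqv_trans by metis
next
  assume "eqv c c'"
  then have "(\<lambda>d. is_formula L d \<and> eqv d c) = (\<lambda>d. is_formula L d \<and> eqv d c')"
    using eqv_sym eqv_trans by blast
  then show "cls c = cls c'" by (simp add: cls_def)
qed

lemma code_of_cls:
  assumes "is_formula L c"
  shows "is_formula L (code_of (cls c))" "eqv (code_of (cls c)) c"
proof -
  have "is_formula L (code_of (cls c)) \<and> cls (code_of (cls c)) = cls c"
    unfolding code_of_def by (rule someI[of _ c]) (simp add: assms)
  then show "is_formula L (code_of (cls c))" "eqv (code_of (cls c)) c"
    using assms cls_eq_iff by auto
qed

lemma eventually_val_in_carrier: "\<forall>\<^sub>F p in U. val c p \<in> carrier (fst p)"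
  using structures by eventually_elim (auto simp: val_def intro: code_value_in_carrier)

lemma eventually_map_code_of_cls:
  assumes "\<And>t. t \<in> set ts \<Longrightarrow> is_formula L (c t)"
    and "\<And>t. t \<in> set ts \<Longrightarrow> \<forall>\<^sub>F p in U. val (c t) p = h p t"
  shows "\<forall>\<^sub>F p in U. map (\<lambda>t. val (code_of (cls (c t))) p) ts = map (h p) ts"
proof -
  have "\<forall>\<^sub>F p in U. val (code_of (cls (c t))) p = h p t" if "t \<in> set ts" for t
    using code_of_cls(2)[OF assms(1)[OF that], unfolded eqv_def] assms(2)[OF that]
    by eventually_elim simp
  then have "\<forall>\<^sub>F p in U. \<forall>t \<in> set ts. val (code_of (cls (c t))) p = h p t"
    by (intro eventually_ball_finite) auto
  then show ?thesis by eventually_elim simp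
qed

lemma ultraprod_structure: "is_structure L ultraprod"
proof -
  have "cls (fun_code f (map code_of us)) \<in> cls ` {c. is_formula L c}"
    if "f \<in> fsyms L" "length us = farity L f" "set us \<subseteq> cls ` {c. is_formula L c}" for f us
  proof -
    have "is_formula L (code_of u)" if "u \<in> set us" for u
      using that \<open>set us \<subseteq> _\<close> code_of_cls(1) by auto
    then show ?thesis
      using that by (intro imageI) (auto intro!: is_formula_fun_code)
  qed
  moreover have "cls Fls \<in> cls ` {c. is_formula L c}" by simp
  ultimately show ?thesis
    unfolding is_structure_def ultraprod_simps by blast
qed

definition represents :: "(nat \<Rightarrow> ('f, 'r) fm) \<Rightarrow> 'f tm \<Rightarrow> ('f, 'r) fm \<Rightarrow> bool" where
  "represents E t c \<longleftrightarrow> is_formula L c \<and> eval ultraprod (\<lambda>n. cls (E n)) t = cls c \<and>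
    (\<forall>\<^sub>F p in U. val c p = eval (fst p) (\<lambda>n. val (E n) p) t)"

text \<open>Function symbols act on \<open>ultraprod\<close> through chosen representatives, which
  agree with the given codes only almost everywhere. A term has finitely many arguments, so these
  agreements hold jointly almost everywhere, and \<open>fun_code\<close> of the representatives is
  the required code.\<close>

lemma represents_exists:
  assumes "\<And>n. is_formula L (E n)" "is_term L t"
  shows "\<exists>c. represents E t c"
  using assms(2)
proof (induction t)
  case (Var n)
  then show ?case using assms(1) by (intro exI[of _ "E n"]) (simp add: represents_def)
next
  case (Fn f ts)
  then have f: "f \<in> fsyms L" "length ts = farity L f" by auto
  let ?ev = "\<lambda>p. eval (fst p) (\<lambda>n. val (E n) p)"
  have "\<exists>c. represents E t c" if "t \<in> set ts" for t
    using Fn that by auto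
  then obtain c where "\<And>t. t \<in> set ts \<Longrightarrow> represents E t (c t)"
    by metis
  then have c: "\<And>t. t \<in> set ts \<Longrightarrow> is_formula L (c t)"
      "\<And>t. t \<in> set ts \<Longrightarrow> eval ultraprod (\<lambda>n. cls (E n)) t = cls (c t)"
      "\<And>t. t \<in> set ts \<Longrightarrow> \<forall>\<^sub>F p in U. val (c t) p = ?ev p t"
    unfolding represents_def by blast+
  let ?d = "fun_code f (map (\<lambda>t. code_of (cls (c t))) ts)"
  have "is_formula L ?d"
    using f c(1) code_of_cls(1) by (intro is_formula_fun_code) auto
  moreover have "map (eval ultraprod (\<lambda>n. cls (E n))) ts = map (\<lambda>t. cls (c t)) ts"
    using c(2) by simp
  then have "eval ultraprod (\<lambda>n. cls (E n)) (Fn f ts) = cls ?d"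
    by (simp only: eval.simps sat.simps ultraprod_simps map_map comp_def)
  moreover have "\<forall>\<^sub>F p in U. map (\<lambda>t. val (code_of (cls (c t))) p) ts = map (?ev p) ts"
    using c(1,3) by (rule eventually_map_code_of_cls)
  then have "\<forall>\<^sub>F p in U. val ?d p = ?ev p (Fn f ts)"
    using structures
  proof eventually_elim
    case (elim p)
    then have "val ?d p = fint (fst p) f (map (\<lambda>t. val (code_of (cls (c t))) p) ts)"
      using f code_value_fun_code[of L "fst p" "snd p" f "map (\<lambda>t. code_of (cls (c t))) ts"]
      by (simp add: val_def comp_def)
    with elim show ?case by (simp only: eval.simps)
  qed
  ultimately show ?case unfolding represents_def by blast
qed

text \<open>Los's theorem for codes. The quantifier is the delicate case: pointwise counterexamples
  have to be assembled into a code, and the Skolem function of the quantified formula itself is that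
  code.\<close>

lemma sat_ultraprod:
  assumes "\<And>n. is_formula L (E n)" "is_formula L \<phi>"
  shows "sat ultraprod (\<lambda>n. cls (E n)) \<phi> \<longleftrightarrow> (\<forall>\<^sub>F p in U. sat (fst p) (\<lambda>n. val (E n) p) \<phi>)"
  using assms
proof (induction \<phi> arbitrary: E)
  case Fls
  then show ?case using proper by (simp add: eventually_False)
next
  case (Eql s t)
  then obtain c d where c: "is_formula L c" "eval ultraprod (\<lambda>n. cls (E n)) s = cls c"
      "\<forall>\<^sub>F p in U. val c p = eval (fst p) (\<lambda>n. val (E n) p) s"
    and d: "is_formula L d" "eval ultraprod (\<lambda>n. cls (E n)) t = cls d"
      "\<forall>\<^sub>F p in U. val d p = eval (fst p) (\<lambda>n. val (E n) p) t"
    using represents_exists[of E s] represents_exists[of E t]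
    unfolding represents_def by auto
  have "sat ultraprod (\<lambda>n. cls (E n)) (Eql s t) \<longleftrightarrow> eqv c d"
    using c(1,2) d(1,2) by (simp add: cls_eq_iff)
  also have "\<dots> \<longleftrightarrow> (\<forall>\<^sub>F p in U. sat (fst p) (\<lambda>n. val (E n) p) (Eql s t))"
    unfolding eqv_def using eventually_conj[OF c(3) d(3)]
    by (intro eventually_subst) (auto elim: eventually_mono)
  finally show ?case .
next
  case (Rel r ts)
  let ?ev = "\<lambda>p. eval (fst p) (\<lambda>n. val (E n) p)"
  have "\<exists>c. represents E t c" if "t \<in> set ts" for t
    using Rel that by (intro represents_exists) auto
  then obtain c where "\<And>t. t \<in> set ts \<Longrightarrow> represents E t (c t)"
    by metis
  then have c: "\<And>t. t \<in> set ts \<Longrightarrow> is_formula L (c t)"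
      "\<And>t. t \<in> set ts \<Longrightarrow> eval ultraprod (\<lambda>n. cls (E n)) t = cls (c t)"
      "\<And>t. t \<in> set ts \<Longrightarrow> \<forall>\<^sub>F p in U. val (c t) p = ?ev p t"
    unfolding represents_def by blast+
  have "map (eval ultraprod (\<lambda>n. cls (E n))) ts = map (\<lambda>t. cls (c t)) ts"
    using c(2) by simp
  then have "sat ultraprod (\<lambda>n. cls (E n)) (Rel r ts) \<longleftrightarrow>
      (\<forall>\<^sub>F p in U. rint (fst p) r (map (\<lambda>t. val (code_of (cls (c t))) p) ts))"
    by (simp only: eval.simps sat.simps ultraprod_simps map_map comp_def)
  also have "\<dots> \<longleftrightarrow> (\<forall>\<^sub>F p in U. rint (fst p) r (map (?ev p) ts))"
  proof (rule eventually_subst)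
    have "\<forall>\<^sub>F p in U. map (\<lambda>t. val (code_of (cls (c t))) p) ts = map (?ev p) ts"
      using c(1,3) by (rule eventually_map_code_of_cls)
    then show "\<forall>\<^sub>F p in U. rint (fst p) r (map (\<lambda>t. val (code_of (cls (c t))) p) ts) =
        rint (fst p) r (map (?ev p) ts)"
      by (rule eventually_mono) (simp only:)
  qed
  finally show ?case by simp
next
  case (Imp \<phi> \<psi>)
  then show ?case by (simp add: eventually_imp_iff)
next
  case (Forall v \<phi>)
  have upd: "sat ultraprod ((\<lambda>n. cls (E n))(v := cls c)) \<phi> \<longleftrightarrow>
      (\<forall>\<^sub>F p in U. sat (fst p) ((\<lambda>n. val (E n) p)(v := val c p)) \<phi>)" if "is_formula L c" for c
  proof -
    have "(\<lambda>n. cls ((E(v := c)) n)) = (\<lambda>n. cls (E n))(v := cls c)"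
      "\<And>p. (\<lambda>n. val ((E(v := c)) n) p) = (\<lambda>n. val (E n) p)(v := val c p)" by auto
    then show ?thesis
      using Forall.IH[of "E(v := c)"] Forall.prems that by simp
  qed
  show ?case
  proof
    assume all: "\<forall>\<^sub>F p in U. sat (fst p) (\<lambda>n. val (E n) p) (Forall v \<phi>)"
    have "sat ultraprod ((\<lambda>n. cls (E n))(v := cls c)) \<phi>" if "is_formula L c" for c
      unfolding upd[OF that] using all eventually_val_in_carrier[of c] by eventually_elim simp
    then show "sat ultraprod (\<lambda>n. cls (E n)) (Forall v \<phi>)" by (auto simp: ultraprod_simps)
  next
    assume sat: "sat ultraprod (\<lambda>n. cls (E n)) (Forall v \<phi>)"
    \<comment> \<open>A code applies a Skolem function to a finite list, so only the values at
      variables below \<open>m\<close> are handed over. The others become the default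
      \<open>snd p 0\<close>, which \<phi> does not see.\<close>
    obtain m where m: "\<And>w. w \<in> fvars \<phi> \<Longrightarrow> w < m"
      using finite_fvars finite_nat_set_iff_bounded by metis
    let ?c = "Imp (Forall v \<phi>) (list_code (map E [0..<m]))"
    have c: "is_formula L ?c"
      using Forall.prems by (simp add: is_formula_list_code)
    have witness: "\<not> sat (fst p) ((\<lambda>n. val (E n) p)(v := val ?c p)) \<phi>"
      if refuted: "\<not> sat (fst p) (\<lambda>n. val (E n) p) (Forall v \<phi>)" for p
    proof -
      let ?e = "\<lambda>n. if n < m then val (E n) p else snd p 0"
      have agree: "sat (fst p) ((\<lambda>n. val (E n) p)(v := a)) \<phi> = sat (fst p) (?e(v := a)) \<phi>" for a
        using m by (intro sat_cong) simp
      have "val ?c p = skolem_witness (fst p) (snd p 0) ?e (Forall v \<phi>)"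
        by (simp add: val_def code_values_list_code Let_def cong: if_cong)
      moreover obtain a where "a \<in> carrier (fst p)" "\<not> sat (fst p) (?e(v := a)) \<phi>"
        using refuted unfolding sat.simps agree by blast
      then have "\<not> sat (fst p) (?e(v := skolem_witness (fst p) (snd p 0) ?e (Forall v \<phi>))) \<phi>"
        by (rule skolem_witness_refutes)
      ultimately show ?thesis
        unfolding agree by (simp only: simp_thms)
    qed
    show "\<forall>\<^sub>F p in U. sat (fst p) (\<lambda>n. val (E n) p) (Forall v \<phi>)"
    proof (rule ccontr)
      assume "\<not> ?thesis"
      then have "\<forall>\<^sub>F p in U. \<not> sat (fst p) (\<lambda>n. val (E n) p) (Forall v \<phi>)"
        by (rule eventually_not_iff[THEN iffD2])
      then have "\<forall>\<^sub>F p in U. \<not> sat (fst p) ((\<lambda>n. val (E n) p)(v := val ?c p)) \<phi>"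
        by (rule eventually_mono) (rule witness)
      then have "\<not> sat ultraprod ((\<lambda>n. cls (E n))(v := cls ?c)) \<phi>"
        unfolding upd[OF c] eventually_not_iff .
      moreover have "cls ?c \<in> carrier ultraprod"
        unfolding ultraprod_simps using c by blast
      ultimately show False using sat unfolding sat.simps by blast
    qed
  qed
qed

end

theorem compactness:
  fixes L :: "('f, 'r) lang"
  assumes "large_universe TYPE('u) L" and formulas: "\<And>\<gamma>. \<gamma> \<in> \<Gamma> \<Longrightarrow> is_formula L \<gamma>"
    and fin_sat: "\<And>\<Gamma>'. finite \<Gamma>' \<Longrightarrow> \<Gamma>' \<subseteq> \<Gamma> \<Longrightarrow> \<exists>(M :: ('f, 'r, 'v) struct) e.
      is_structure L M \<and> range e \<subseteq> carrier M \<and> (\<forall>\<gamma> \<in> \<Gamma>'. sat M e \<gamma>)"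
  shows "\<exists>(N :: ('f, 'r, 'u) struct) e.
      is_structure L N \<and> range e \<subseteq> carrier N \<and> (\<forall>\<gamma> \<in> \<Gamma>. sat N e \<gamma>)"
proof -
  define S where "S = {p :: ('f, 'r, 'v) struct \<times> (nat \<Rightarrow> 'v).
    is_structure L (fst p) \<and> range (snd p) \<subseteq> carrier (fst p)}"
  \<comment> \<open>Finite satisfiability makes this filter proper. The tautology
    \<open>Imp Fls Fls\<close> contributes \<open>S\<close> itself, so that almost every index is a
    structure with an assignment even when \<Gamma> is empty.\<close>
  define F where "F = (INF \<gamma>\<in>insert (Imp Fls Fls) \<Gamma>. principal {p \<in> S. sat (fst p) (snd p) \<gamma>})"
  have "F \<noteq> bot"
    unfolding F_def
  proof (rule INF_filter_not_bot)
    fix B assume B: "B \<subseteq> insert (Imp Fls Fls) \<Gamma>" "finite B"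
    obtain M :: "('f, 'r, 'v) struct" and e where
      "is_structure L M" "range e \<subseteq> carrier M" "\<forall>\<gamma> \<in> B - {Imp Fls Fls}. sat M e \<gamma>"
      using fin_sat[of "B - {Imp Fls Fls}"] B by blast
    then have Me: "(M, e) \<in> S" "\<forall>\<gamma> \<in> B. sat M e \<gamma>"
      by (auto simp: S_def)
    have "principal {(M, e)} \<le> (INF \<gamma>\<in>B. principal {p \<in> S. sat (fst p) (snd p) \<gamma>})"
      using Me by (intro INF_greatest) auto
    then show "(INF \<gamma>\<in>B. principal {p \<in> S. sat (fst p) (snd p) \<gamma>}) \<noteq> bot"
      by (auto simp: bot_unique principal_eq_bot_iff)
  qed
  then obtain U where U: "U \<le> F" "U \<noteq> bot" "\<And>P. eventually P U \<or> eventually (\<lambda>x. \<not> P x) U"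
    using ultrafilter_exists[of F] by blast
  have ev: "\<forall>\<^sub>F p in U. p \<in> S \<and> sat (fst p) (snd p) \<gamma>" if "\<gamma> \<in> insert (Imp Fls Fls) \<Gamma>" for \<gamma>
  proof (rule filter_leD[OF U(1)])
    have "F \<le> principal {p \<in> S. sat (fst p) (snd p) \<gamma>}"
      unfolding F_def using that by (rule INF_lower)
    then show "\<forall>\<^sub>F p in F. p \<in> S \<and> sat (fst p) (snd p) \<gamma>"
      by (simp add: le_principal)
  qed
  obtain g :: "('f, 'r) fm \<Rightarrow> 'u" where g: "inj_on g {\<phi>. is_formula L \<phi>}"
    using assms(1) unfolding large_universe_def lepoll_def by blast
  interpret skolem_ultraproduct L U g
  proof
    show "\<forall>\<^sub>F p in U. is_structure L (fst p) \<and> range (snd p) \<subseteq> carrier (fst p)"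
      using ev[of "Imp Fls Fls"] by (auto simp: S_def elim: eventually_mono)
  qed (fact U g)+
  \<comment> \<open>The code of the variable \<open>n\<close> takes at each index the value of the
    assignment there; its class is the value of \<open>n\<close> in the new model.\<close>
  define E :: "nat \<Rightarrow> ('f, 'r) fm" where "E n = Eql (Var n) (Var n)" for n
  have "sat ultraprod (\<lambda>n. cls (E n)) \<gamma>" if "\<gamma> \<in> \<Gamma>" for \<gamma>
  proof -
    have "(\<lambda>n. val (E n) p) = snd p" for p by (auto simp: E_def val_def)
    then show ?thesis
      using ev[of \<gamma>] that formulas[OF that]
      by (subst sat_ultraprod) (auto simp: E_def elim: eventually_mono)
  qed
  moreover have "range (\<lambda>n. cls (E n)) \<subseteq> carrier ultraprod"
    by (auto simp: ultraprod_simps E_def)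
  ultimately show ?thesis using ultraprod_structure by blast
qed

section \<open>Alternations in linear orders\<close>

definition linear_on :: "'u set \<Rightarrow> ('u \<Rightarrow> 'u \<Rightarrow> bool) \<Rightarrow> bool" where
  "linear_on X R \<longleftrightarrow> (\<forall>a\<in>X. \<not> R a a) \<and>
     (\<forall>a\<in>X. \<forall>b\<in>X. \<forall>c\<in>X. R a b \<longrightarrow> R b c \<longrightarrow> R a c) \<and>
     (\<forall>a\<in>X. \<forall>b\<in>X. R a b \<or> a = b \<or> R b a)"

definition initial_in :: "'u set \<Rightarrow> ('u \<Rightarrow> 'u \<Rightarrow> bool) \<Rightarrow> 'u set \<Rightarrow> bool" where
  "initial_in X R J \<longleftrightarrow> J \<subseteq> X \<and> (\<forall>a\<in>J. \<forall>b\<in>X. R b a \<longrightarrow> b \<in> J)"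

lemma initial_in_comparable:
  assumes "linear_on X R" "initial_in X R J" "initial_in X R J'"
  shows "J \<subseteq> J' \<or> J' \<subseteq> J"
proof (rule ccontr)
  assume "\<not> ?thesis"
  then obtain a b where "a \<in> J" "a \<notin> J'" "b \<in> J'" "b \<notin> J" by blast
  moreover from this have "R a b \<or> a = b \<or> R b a"
    using assms unfolding linear_on_def initial_in_def by blast
  ultimately show False
    using assms unfolding initial_in_def by blast
qed

lemma least_member_of_chain:
  assumes "finite I" and chain: "\<And>i j. i \<in> I \<Longrightarrow> j \<in> I \<Longrightarrow> J i \<subseteq> J j \<or> J j \<subseteq> J i"
    and "\<exists>i\<in>I. a \<in> J i"
  shows "\<exists>i\<in>I. \<forall>j\<in>I. a \<in> J j \<longleftrightarrow> J i \<subseteq> J j"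
proof -
  let ?A = "J ` {i \<in> I. a \<in> J i}"
  have "finite ?A" "?A \<noteq> {}" using assms by auto
  then obtain S where S: "S \<in> ?A" "\<forall>b\<in>?A. b \<le> S \<longrightarrow> S = b"
    using finite_has_minimal[of ?A] by blast
  then obtain i where i: "i \<in> I" "a \<in> J i" "S = J i" by blast
  have "J i \<subseteq> J j" if "j \<in> I" "a \<in> J j" for j
    using S(2) i that chain[of i j] by blast
  then show ?thesis using i by (intro bexI[of _ i]) auto
qed

text \<open>\<open>alternation R K D k a\<close> says that \<open>K\<close> contains a chain of \<open>k + 1\<close> elements ending in \<open>a\<close>
  which lie alternately inside and outside \<open>D\<close>, beginning inside. The chain is strictly increasing,
  although only weak inequalities are required, because consecutive elements differ in membership.\<close>

primrec alternation :: "('u \<Rightarrow> 'u \<Rightarrow> bool) \<Rightarrow> 'u set \<Rightarrow> 'u set \<Rightarrow> nat \<Rightarrow> 'u \<Rightarrow> bool" where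
  "alternation R K D 0 a \<longleftrightarrow> a \<in> K \<and> a \<in> D"
| "alternation R K D (Suc k) a \<longleftrightarrow>
     a \<in> K \<and> (a \<in> D \<longleftrightarrow> odd k) \<and> (\<exists>b. (R b a \<or> b = a) \<and> alternation R K D k b)"

definition before_alternation ::
    "'u set \<Rightarrow> ('u \<Rightarrow> 'u \<Rightarrow> bool) \<Rightarrow> 'u set \<Rightarrow> 'u set \<Rightarrow> nat \<Rightarrow> 'u set" where
  "before_alternation X R K D k = {a \<in> X. \<not> (\<exists>b. (R b a \<or> b = a) \<and> alternation R K D k b)}"

lemma alternation_in: "alternation R K D k a \<Longrightarrow> a \<in> K"
  by (cases k) auto

lemma alternation_parity: "alternation R K D k a \<Longrightarrow> a \<in> D \<longleftrightarrow> even k"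
  by (cases k) auto

lemma alternation_mono: "K \<subseteq> K' \<Longrightarrow> alternation R K D k a \<Longrightarrow> alternation R K' D k a"
  by (induction k arbitrary: a) auto

text \<open>The condition to begin inside \<open>D\<close> sits at the lower end of the chain, so
  elements may be dropped at the upper end. This allows every bound to be enlarged.\<close>

lemma alternation_shorter:
  assumes "alternation R K D n a" "m \<le> n"
  shows "\<exists>b. alternation R K D m b"
  using assms(2,1)
proof (induction n arbitrary: a rule: dec_induct)
  case (step n)
  then show ?case by auto
qed auto

text \<open>Going up a chain, membership in initial segments can only be lost. Two consecutive
  elements differ with respect to \<open>D\<close>, so by \<open>determined\<close> at least one
  segment is lost at every step. The cardinality on the left is the potential that makes the
  induction run.\<close>

lemma alternation_length_bound:
  assumes "finite \<J>" and "K \<subseteq> X" and initial: "\<And>J. J \<in> \<J> \<Longrightarrow> initial_in X R J"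
    and determined: "\<And>a b. a \<in> K \<Longrightarrow> b \<in> K \<Longrightarrow> (\<forall>J\<in>\<J>. a \<in> J \<longleftrightarrow> b \<in> J) \<Longrightarrow> a \<in> D \<longleftrightarrow> b \<in> D"
    and "alternation R K D k a"
  shows "card {J \<in> \<J>. a \<in> J} + k \<le> card \<J>"
  using assms(5)
proof (induction k arbitrary: a)
  case 0
  then show ?case using assms(1) by (simp add: card_mono)
next
  case (Suc k)
  then obtain b where b: "R b a \<or> b = a" "alternation R K D k b" by auto
  have K: "a \<in> K" "b \<in> K"
    using alternation_in[OF Suc.prems] alternation_in[OF b(2)] by blast+
  have "{J \<in> \<J>. a \<in> J} \<subseteq> {J \<in> \<J>. b \<in> J}"
    using b(1) K assms(2) initial unfolding initial_in_def by blast
  moreover have "{J \<in> \<J>. a \<in> J} \<noteq> {J \<in> \<J>. b \<in> J}"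
  proof
    assume "{J \<in> \<J>. a \<in> J} = {J \<in> \<J>. b \<in> J}"
    then have "a \<in> D \<longleftrightarrow> b \<in> D" by (intro determined K) blast
    then show False
      using alternation_parity[OF Suc.prems] alternation_parity[OF b(2)] by simp
  qed
  ultimately have "card {J \<in> \<J>. a \<in> J} < card {J \<in> \<J>. b \<in> J}"
    using assms(1) by (intro psubset_card_mono) auto
  then show ?case using Suc.IH[OF b(2)] by simp
qed

lemma initial_before_alternation:
  assumes "linear_on X R" "K \<subseteq> X"
  shows "initial_in X R (before_alternation X R K D k)"
proof -
  have "R c a \<or> c = a"
    if "R b a" "R c b \<or> c = b" "alternation R K D k c" "a \<in> X" "b \<in> X" for a b c
    using that alternation_in[OF that(3)] assms unfolding linear_on_def by blast
  then show ?thesis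
    unfolding initial_in_def before_alternation_def by blast
qed

text \<open>An element of \<open>K\<close> lies in \<open>D\<close> iff the longest alternation below it ends inside \<open>D\<close>.\<close>

lemma in_iff_before_alternation:
  assumes "K \<subseteq> X" and "a \<in> K" and bound: "\<And>b. \<not> alternation R K D n b"
  shows "a \<in> D \<longleftrightarrow> (\<exists>k. k < n \<and> even k \<and> a \<notin> before_alternation X R K D k \<and>
           a \<in> before_alternation X R K D (Suc k))"
proof -
  let ?reach = "\<lambda>k. \<exists>b. (R b a \<or> b = a) \<and> alternation R K D k b"
  have before: "a \<in> before_alternation X R K D k \<longleftrightarrow> \<not> ?reach k" for k
    using assms(1,2) by (auto simp: before_alternation_def)
  \<comment> \<open>If \<open>a\<close> had the other parity, it could be appended to the
    alternation and would lengthen it.\<close>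
  have extend: "a \<in> D \<longleftrightarrow> even k" if "?reach k" "\<not> ?reach (Suc k)" for k
  proof (rule ccontr)
    assume "\<not> ?thesis"
    then have "alternation R K D (Suc k) a" using that(1) assms(2) by auto
    then show False using that(2) by blast
  qed
  \<comment> \<open>For \<open>a\<close> in \<open>D\<close> the element \<open>a\<close> alone is
    an alternation of index 0, while \<open>bound\<close> excludes index \<open>n\<close>; so the
    index at which alternations stop lies below \<open>n\<close>.\<close>
  have last: "\<exists>k<n. P k \<and> \<not> P (Suc k)" if "P 0" "\<not> P n" for P :: "nat \<Rightarrow> bool" and n
    using that by (induction n) (auto intro: less_SucI)
  show ?thesis
  proof
    assume "a \<in> D"
    then have "?reach 0" using assms(2) by auto
    moreover have "\<not> ?reach n" using bound by blast
    ultimately obtain k where "k < n" "?reach k" "\<not> ?reach (Suc k)"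
      using last[of ?reach n] by blast
    then show "\<exists>k. k < n \<and> even k \<and> a \<notin> before_alternation X R K D k \<and>
           a \<in> before_alternation X R K D (Suc k)"
      using extend \<open>a \<in> D\<close> unfolding before by blast
  next
    assume "\<exists>k. k < n \<and> even k \<and> a \<notin> before_alternation X R K D k \<and>
           a \<in> before_alternation X R K D (Suc k)"
    then show "a \<in> D" using extend unfolding before by blast
  qed
qed

section \<open>Defining alternations\<close>

text \<open>Replacement of the free variable \<open>y\<close> by \<open>z\<close>, expressed with a
  quantifier and an equation. This avoids syntactic substitution and with it the renaming of bound
  variables.\<close>

definition Inst :: "nat \<Rightarrow> nat \<Rightarrow> ('f, 'r) fm \<Rightarrow> ('f, 'r) fm" where
  "Inst y z \<phi> = Exists y (Conj (Eql (Var y) (Var z)) \<phi>)"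

lemma is_formula_Inst [simp]: "is_formula L (Inst y z \<phi>) \<longleftrightarrow> is_formula L \<phi>"
  by (simp add: Inst_def)

lemma fvars_Inst: "y \<noteq> z \<Longrightarrow> fvars (Inst y z \<phi>) = insert z (fvars \<phi> - {y})"
  by (auto simp: Inst_def)

lemma sat_Inst:
  assumes "y \<noteq> z" "e z \<in> carrier M"
  shows "sat M e (Inst y z \<phi>) \<longleftrightarrow> sat M (e(y := e z)) \<phi>"
  using assms by (auto simp: Inst_def)

fun Insts :: "nat list \<Rightarrow> nat list \<Rightarrow> ('f, 'r) fm \<Rightarrow> ('f, 'r) fm" where
  "Insts (y # ys) (z # zs) \<phi> = Inst y z (Insts ys zs \<phi>)"
| "Insts _ _ \<phi> = \<phi>"

lemma is_formula_Insts [simp]: "is_formula L (Insts ys zs \<phi>) \<longleftrightarrow> is_formula L \<phi>"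
  by (induction ys zs \<phi> rule: Insts.induct) auto

lemma fvars_Insts:
  assumes "length zs = length ys" "set ys \<inter> set zs = {}"
  shows "fvars (Insts ys zs \<phi>) \<subseteq> (fvars \<phi> - set ys) \<union> set zs"
  using assms by (induction zs ys rule: list_induct2) (auto simp: fvars_Inst)

text \<open>Because the two lists are disjoint, updating a variable of \<open>ys\<close> leaves the
  values at \<open>zs\<close> alone, so the nested replacements act simultaneously.\<close>

lemma sat_Insts:
  assumes "length zs = length ys" "set ys \<inter> set zs = {}" "distinct ys" "e ` set zs \<subseteq> carrier M"
  shows "sat M e (Insts ys zs \<phi>) \<longleftrightarrow>
    sat M (\<lambda>v. if v \<in> set ys then assign ys (map e zs) v else e v) \<phi>"
  using assms
proof (induction zs ys arbitrary: e rule: list_induct2)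
  case (Cons z zs y ys)
  let ?e = "e(y := e z)"
  have map: "map ?e zs = map e zs" using Cons.prems by auto
  have "sat M e (Insts (y # ys) (z # zs) \<phi>) \<longleftrightarrow> sat M ?e (Insts ys zs \<phi>)"
    using Cons.prems by (simp add: sat_Inst)
  also have "\<dots> \<longleftrightarrow> sat M (\<lambda>v. if v \<in> set ys then assign ys (map ?e zs) v else ?e v) \<phi>"
    using Cons.prems by (intro Cons.IH) auto
  also have "\<dots> \<longleftrightarrow> sat M (\<lambda>v. if v \<in> set (y # ys)
      then assign (y # ys) (map e (z # zs)) v else e v) \<phi>"
    unfolding map using Cons.prems by (intro sat_cong) auto
  finally show ?case .
qed simp

section \<open>Finite conjunctions and the formulas expressing alternations\<close>

definition Conjs :: "('f, 'r) fm set \<Rightarrow> ('f, 'r) fm" where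
  "Conjs A = foldr Conj (SOME \<phi>s. set \<phi>s = A) (Neg Fls)"

lemma Conjs_list:
  assumes "finite A"
  obtains \<phi>s where "set \<phi>s = A" "Conjs A = foldr Conj \<phi>s (Neg Fls)"
  using someI_ex[OF finite_list[OF assms]] unfolding Conjs_def by blast

lemma is_formula_Conjs: "finite A \<Longrightarrow> is_formula L (Conjs A) \<longleftrightarrow> (\<forall>\<phi>\<in>A. is_formula L \<phi>)"
proof (erule Conjs_list)
  fix \<phi>s assume "set \<phi>s = A" "Conjs A = foldr Conj \<phi>s (Neg Fls)"
  moreover have "is_formula L (foldr Conj \<phi>s (Neg Fls)) \<longleftrightarrow> (\<forall>\<phi>\<in>set \<phi>s. is_formula L \<phi>)"
    by (induction \<phi>s) auto
  ultimately show ?thesis by simp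
qed

lemma fvars_Conjs: "finite A \<Longrightarrow> fvars (Conjs A) = (\<Union>\<phi>\<in>A. fvars \<phi>)"
proof (erule Conjs_list)
  fix \<phi>s assume "set \<phi>s = A" "Conjs A = foldr Conj \<phi>s (Neg Fls)"
  moreover have "fvars (foldr Conj \<phi>s (Neg Fls)) = (\<Union>\<phi>\<in>set \<phi>s. fvars \<phi>)"
    by (induction \<phi>s) auto
  ultimately show ?thesis by simp
qed

lemma sat_Conjs: "finite A \<Longrightarrow> sat M e (Conjs A) \<longleftrightarrow> (\<forall>\<phi>\<in>A. sat M e \<phi>)"
proof (erule Conjs_list)
  fix \<phi>s assume "set \<phi>s = A" "Conjs A = foldr Conj \<phi>s (Neg Fls)"
  moreover have "sat M e (foldr Conj \<phi>s (Neg Fls)) \<longleftrightarrow> (\<forall>\<phi>\<in>set \<phi>s. sat M e \<phi>)"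
    by (induction \<phi>s) auto
  ultimately show ?thesis by simp
qed

definition At_or_below :: "'r \<Rightarrow> nat \<Rightarrow> nat \<Rightarrow> ('f, 'r) fm \<Rightarrow> ('f, 'r) fm" where
  "At_or_below lt x z \<phi> =
     Exists z (Conj (Disj (Less lt z x) (Eql (Var z) (Var x))) (Inst x z \<phi>))"

text \<open>One auxiliary variable \<open>z\<close> serves at all levels: \<open>At_or_below\<close>
  binds it, so it is not free in the formula to which the next level is applied, provided that it is
  free in neither \<kappa> nor \<phi>.\<close>

primrec Alternation ::
    "'r \<Rightarrow> nat \<Rightarrow> nat \<Rightarrow> ('f, 'r) fm \<Rightarrow> ('f, 'r) fm \<Rightarrow> nat \<Rightarrow> ('f, 'r) fm" where
  "Alternation lt x z \<kappa> \<phi> 0 = Conj \<kappa> \<phi>"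
| "Alternation lt x z \<kappa> \<phi> (Suc k) = Conj \<kappa> (Conj (if odd k then \<phi> else Neg \<phi>)
     (At_or_below lt x z (Alternation lt x z \<kappa> \<phi> k)))"

lemma is_formula_At_or_below:
  "lt \<in> rsyms L \<Longrightarrow> rarity L lt = 2 \<Longrightarrow>
    is_formula L (At_or_below lt x z \<phi>) \<longleftrightarrow> is_formula L \<phi>"
  by (simp add: At_or_below_def Less_def)

lemma fvars_At_or_below: "x \<noteq> z \<Longrightarrow> fvars (At_or_below lt x z \<phi>) = insert x (fvars \<phi> - {z})"
  by (auto simp: At_or_below_def Less_def fvars_Inst)

lemma sat_At_or_below:
  assumes "x \<noteq> z" "z \<notin> fvars \<phi>"
  shows "sat M e (At_or_below lt x z \<phi>) \<longleftrightarrow>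
    (\<exists>b \<in> carrier M. (rint M lt [b, e x] \<or> b = e x) \<and> sat M (e(x := b)) \<phi>)"
proof -
  have "sat M (e(z := b, x := b)) \<phi> = sat M (e(x := b)) \<phi>" for b
    using assms by (intro sat_cong) auto
  then show ?thesis
    using assms(1) by (auto simp: At_or_below_def Less_def sat_Inst)
qed

lemma is_formula_Alternation:
  assumes "lt \<in> rsyms L" "rarity L lt = 2" "is_formula L \<kappa>" "is_formula L \<phi>"
  shows "is_formula L (Alternation lt x z \<kappa> \<phi> k)"
  using assms by (induction k) (auto simp: is_formula_At_or_below)

lemma fvars_Alternation:
  "x \<noteq> z \<Longrightarrow> fvars (Alternation lt x z \<kappa> \<phi> k) \<subseteq> insert x (fvars \<kappa> \<union> fvars \<phi>)"
  by (induction k) (auto simp: fvars_At_or_below)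

lemma sat_Alternation:
  assumes "x \<noteq> z" "z \<notin> fvars \<kappa>" "z \<notin> fvars \<phi>" "a \<in> carrier M"
  shows "sat M (e(x := a)) (Alternation lt x z \<kappa> \<phi> k) \<longleftrightarrow>
    alternation (\<lambda>a b. rint M lt [a, b]) {a \<in> carrier M. sat M (e(x := a)) \<kappa>}
      {a \<in> carrier M. sat M (e(x := a)) \<phi>} k a"
  using assms(4)
proof (induction k arbitrary: a)
  case (Suc k)
  define alt where "alt = alternation (\<lambda>a b. rint M lt [a, b])
    {a \<in> carrier M. sat M (e(x := a)) \<kappa>} {a \<in> carrier M. sat M (e(x := a)) \<phi>} k"
  have IH: "sat M (e(x := b)) (Alternation lt x z \<kappa> \<phi> k) \<longleftrightarrow> alt b" if "b \<in> carrier M" for b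
    unfolding alt_def by (rule Suc.IH[OF that])
  have in_carrier: "b \<in> carrier M" if "alt b" for b
    using alternation_in[OF that[unfolded alt_def]] by blast
  have "z \<notin> fvars (Alternation lt x z \<kappa> \<phi> k)"
    using assms(1-3) fvars_Alternation by fastforce
  then have "sat M (e(x := a)) (At_or_below lt x z (Alternation lt x z \<kappa> \<phi> k)) \<longleftrightarrow>
      (\<exists>b\<in>carrier M. (rint M lt [b, a] \<or> b = a) \<and> sat M (e(x := b)) (Alternation lt x z \<kappa> \<phi> k))"
    using assms(1) by (simp add: sat_At_or_below)
  also have "\<dots> \<longleftrightarrow> (\<exists>b. (rint M lt [b, a] \<or> b = a) \<and> alt b)"
    using IH in_carrier by blast
  finally have below: "sat M (e(x := a)) (At_or_below lt x z (Alternation lt x z \<kappa> \<phi> k)) \<longleftrightarrow>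
      (\<exists>b. (rint M lt [b, a] \<or> b = a) \<and> alt b)" .
  show ?case
    unfolding Alternation.simps alternation.simps sat_connectives(2) below alt_def[symmetric]
    using Suc.prems by (cases "odd k") simp_all
qed simp

section \<open>Uniform bounds on alternations\<close>

lemma sentence_valid_iff:
  assumes "fvars \<sigma> = {}" "range e \<subseteq> carrier M"
  shows "valid_in M \<sigma> \<longleftrightarrow> sat M e \<sigma>"
  using assms sat_cong[of \<sigma> _ e M] unfolding valid_in_def by blast

text \<open>\<open>entails\<close> only ranges over models in \<open>'u\<close>. A countermodel in
  \<open>'v\<close> would satisfy \<open>T\<close> together with \<open>Neg \<sigma>\<close>, and
  compactness would produce a countermodel in \<open>'u\<close>.\<close>

lemma entails_other_universe:
  fixes L :: "('f, 'r) lang" and M :: "('f, 'r, 'v) struct"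
  assumes "large_universe TYPE('u) L" "is_theory L T" "entails TYPE('u) L T \<sigma>"
    and \<sigma>: "is_formula L \<sigma>" "fvars \<sigma> = {}" and "is_model L T M"
  shows "valid_in M \<sigma>"
proof (rule ccontr)
  assume "\<not> valid_in M \<sigma>"
  then obtain e where e: "range e \<subseteq> carrier M" "\<not> sat M e \<sigma>"
    unfolding valid_in_def by blast
  have M: "is_structure L M" "\<forall>\<gamma>\<in>insert (Neg \<sigma>) T. sat M e \<gamma>"
    using assms(6) e unfolding is_model_def valid_in_def by auto
  have "\<exists>(N :: ('f, 'r, 'u) struct) e'. is_structure L N \<and> range e' \<subseteq> carrier N \<and>
      (\<forall>\<gamma>\<in>insert (Neg \<sigma>) T. sat N e' \<gamma>)"
  proof (rule compactness[OF assms(1)])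
    show "is_formula L \<gamma>" if "\<gamma> \<in> insert (Neg \<sigma>) T" for \<gamma>
      using that assms(2) \<sigma>(1) unfolding is_theory_def by auto
    show "\<exists>(M :: ('f, 'r, 'v) struct) e. is_structure L M \<and> range e \<subseteq> carrier M \<and>
        (\<forall>\<gamma>\<in>\<Gamma>'. sat M e \<gamma>)" if "\<Gamma>' \<subseteq> insert (Neg \<sigma>) T" for \<Gamma>'
      using M e(1) that by blast
  qed
  then obtain N :: "('f, 'r, 'u) struct" and e' where
    N: "is_structure L N" "range e' \<subseteq> carrier N" "\<forall>\<gamma>\<in>insert (Neg \<sigma>) T. sat N e' \<gamma>"
    by blast
  have "is_model L T N"
    using N assms(2) unfolding is_model_def is_theory_def by (auto simp: sentence_valid_iff)
  then have "sat N e' \<sigma>"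
    using assms(3) N(2) unfolding entails_def valid_in_def by blast
  with N(3) show False by simp
qed

lemma model_linear_on:
  fixes L :: "('f, 'r) lang" and M :: "('f, 'r, 'v) struct"
  assumes "large_universe TYPE('u) L" "lt \<in> rsyms L" "rarity L lt = 2" "is_theory L T"
    and extends: "extends TYPE('u) L T (infinite_linear_orderings lt)" and model: "is_model L T M"
  shows "linear_on (carrier M) (\<lambda>a b. rint M lt [a, b])"
proof -
  obtain c where c: "c \<in> carrier M"
    using model unfolding is_model_def is_structure_def by blast
  have ax: "sat M (\<lambda>_. c) \<sigma>"
    if "\<sigma> \<in> infinite_linear_orderings lt" "is_formula L \<sigma>" "fvars \<sigma> = {}" for \<sigma>
  proof -
    have "entails TYPE('u) L T \<sigma>" using extends that(1) by (simp add: extends_def)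
    then have "valid_in M \<sigma>" by (rule entails_other_universe[OF assms(1,4) _ that(2,3) model])
    then show ?thesis using c unfolding valid_in_def by auto
  qed
  have "sat M (\<lambda>_. c) (Forall 0 (Neg (Less lt 0 0)))"
    using assms(2,3) by (intro ax) (auto simp: infinite_linear_orderings_def Less_def)
  then have "\<not> rint M lt [a, a]" if "a \<in> carrier M" for a
    using that by (simp add: Less_def)
  moreover have "sat M (\<lambda>_. c) (Forall 0 (Forall 1 (Forall 2
      (Imp (Less lt 0 1) (Imp (Less lt 1 2) (Less lt 0 2))))))"
    using assms(2,3) by (intro ax) (auto simp: infinite_linear_orderings_def Less_def)
  moreover have "sat M (\<lambda>_. c) (Forall 0 (Forall 1 (Forall 2
      (Imp (Less lt 0 1) (Imp (Less lt 1 2) (Less lt 0 2)))))) \<longleftrightarrow>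
      (\<forall>a\<in>carrier M. \<forall>b\<in>carrier M. \<forall>d\<in>carrier M.
        rint M lt [a, b] \<longrightarrow> rint M lt [b, d] \<longrightarrow> rint M lt [a, d])"
    by (simp add: Less_def)
  moreover have "sat M (\<lambda>_. c)
      (Forall 0 (Forall 1 (Disj (Less lt 0 1) (Disj (Eql (Var 0) (Var 1)) (Less lt 1 0)))))"
    using assms(2,3) by (intro ax) (auto simp: infinite_linear_orderings_def Less_def)
  then have "rint M lt [a, b] \<or> a = b \<or> rint M lt [b, a]"
    if "a \<in> carrier M" "b \<in> carrier M" for a b
    using that by (simp add: Less_def)
  ultimately show ?thesis
    unfolding linear_on_def by meson
qed

section \<open>Sets determined by types and initial segments\<close>

text \<open>\<open>same_type\<close> is only used for formulas with a single free variable.\<close>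

definition same_type :: "('f, 'r, 'u) struct \<Rightarrow> ('f, 'r) fm set \<Rightarrow> 'u \<Rightarrow> 'u \<Rightarrow> bool" where
  "same_type M \<Theta> a b \<longleftrightarrow> (\<forall>\<theta>\<in>\<Theta>. sat M (\<lambda>_. a) \<theta> \<longleftrightarrow> sat M (\<lambda>_. b) \<theta>)"

lemma sat_one_variable:
  "fvars \<theta> \<subseteq> {x} \<Longrightarrow> sat M (e(x := a)) \<theta> \<longleftrightarrow> sat M (\<lambda>_. a) \<theta>"
  by (rule sat_cong) auto

text \<open>A semantic stand-in for a normal form of Boolean combinations: it passes through Boolean
  operations by uniting the data, and it is exactly what bounds alternations. All formulas share the
  variable \<open>x\<close> so that they can be united.\<close>

definition determined_by :: "('f, 'r) lang \<Rightarrow> 'r \<Rightarrow> ('f, 'r, 'u) struct \<Rightarrow> nat \<Rightarrow>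
    ('f, 'r) fm set \<Rightarrow> 'u set set \<Rightarrow> 'u set \<Rightarrow> bool" where
  "determined_by L lt M x \<Theta> \<J> S \<longleftrightarrow>
     finite \<Theta> \<and> (\<forall>\<theta>\<in>\<Theta>. is_formula L \<theta> \<and> fvars \<theta> \<subseteq> {x}) \<and>
     finite \<J> \<and> (\<forall>J\<in>\<J>. initial_in (carrier M) (\<lambda>a b. rint M lt [a, b]) J) \<and>
     (\<forall>a\<in>carrier M. \<forall>b\<in>carrier M. same_type M \<Theta> a b \<longrightarrow> (\<forall>J\<in>\<J>. a \<in> J \<longleftrightarrow> b \<in> J) \<longrightarrow>
       (a \<in> S \<longleftrightarrow> b \<in> S))"

lemma determined_by_Un:
  assumes det: "determined_by L lt M x \<Theta> \<J> S" "determined_by L lt M x \<Theta>' \<J>' S'"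
    and "\<And>a b. a \<in> carrier M \<Longrightarrow> b \<in> carrier M \<Longrightarrow> (a \<in> S \<longleftrightarrow> b \<in> S) \<Longrightarrow>
      (a \<in> S' \<longleftrightarrow> b \<in> S') \<Longrightarrow> (a \<in> S'' \<longleftrightarrow> b \<in> S'')"
  shows "determined_by L lt M x (\<Theta> \<union> \<Theta>') (\<J> \<union> \<J>') S''"
proof -
  have "a \<in> S'' \<longleftrightarrow> b \<in> S''" if "a \<in> carrier M" "b \<in> carrier M"
    "same_type M (\<Theta> \<union> \<Theta>') a b" "\<forall>J\<in>\<J> \<union> \<J>'. a \<in> J \<longleftrightarrow> b \<in> J" for a b
  proof -
    have "same_type M \<Theta> a b" "same_type M \<Theta>' a b"
      using that(3) by (auto simp: same_type_def)
    then have "a \<in> S \<longleftrightarrow> b \<in> S" "a \<in> S' \<longleftrightarrow> b \<in> S'"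
      using det that unfolding determined_by_def by auto
    then show ?thesis using assms(3) that(1,2) by blast
  qed
  then show ?thesis
    using det unfolding determined_by_def by auto
qed

lemma boolean_combination_determined:
  assumes linear: "linear_on (carrier M) (\<lambda>a b. rint M lt [a, b])"
    and "S \<in> boolean_combinations (carrier M) ({C. convex_in lt M C} \<union> {E. definable_over L M {} E})"
  shows "\<exists>\<Theta> \<J>. determined_by L lt M x \<Theta> \<J> S"
  using assms(2)
proof induction
  case (gen S)
  then show ?case
  proof
    assume "S \<in> {C. convex_in lt M C}"
    then have S: "S \<subseteq> carrier M"
      "\<And>a b c. a \<in> S \<Longrightarrow> b \<in> S \<Longrightarrow> c \<in> carrier M \<Longrightarrow> rint M lt [a, c] \<Longrightarrow> rint M lt [c, b] \<Longrightarrow> c \<in> S"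
      unfolding convex_in_def by blast+
    note irrefl = linear[unfolded linear_on_def, THEN conjunct1, rule_format]
    note trans = linear[unfolded linear_on_def, THEN conjunct2, THEN conjunct1, rule_format]
    note total = linear[unfolded linear_on_def, THEN conjunct2, THEN conjunct2, rule_format]
    \<comment> \<open>The convex set is the difference of its downward closure and the set of points
      strictly below it. For empty \<open>S\<close> these are the empty set and the carrier, and the
      difference is still right.\<close>
    define J J' where "J = {a \<in> carrier M. \<exists>c\<in>S. rint M lt [a, c] \<or> a = c}"
      and "J' = {a \<in> carrier M. \<forall>c\<in>S. rint M lt [a, c]}"
    have "a \<in> S \<longleftrightarrow> a \<in> J \<and> a \<notin> J'" if a: "a \<in> carrier M" for a
    proof
      assume "a \<in> S"
      then show "a \<in> J \<and> a \<notin> J'" using a irrefl[OF a] unfolding J_def J'_def by blast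
    next
      assume "a \<in> J \<and> a \<notin> J'"
      then obtain c c' where "c \<in> S" "c' \<in> S" "rint M lt [a, c] \<or> a = c" "\<not> rint M lt [a, c']"
        using a unfolding J_def J'_def by blast
      then show "a \<in> S" using total[OF a, of c'] S a by blast
    qed
    moreover have "initial_in (carrier M) (\<lambda>a b. rint M lt [a, b]) J"
      unfolding initial_in_def J_def using trans S(1) by blast
    moreover have "initial_in (carrier M) (\<lambda>a b. rint M lt [a, b]) J'"
      unfolding initial_in_def J'_def using trans S(1) by blast
    ultimately have "determined_by L lt M x {} {J, J'} S"
      by (simp add: determined_by_def)
    then show ?case by blast
  next
    assume "S \<in> {E. definable_over L M {} E}"
    then obtain \<phi> x' where \<phi>: "is_formula L \<phi>" "fvars \<phi> \<subseteq> {x'}"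
      and S: "S = {a \<in> carrier M. sat M (assign [x'] [a]) \<phi>}"
      unfolding definable_over_def by auto
    \<comment> \<open>The definition of \<open>S\<close> may use any variable; it is moved to the
      common \<open>x\<close>. The case distinction is there because \<open>Inst\<close> is correct
      only for distinct variables.\<close>
    define \<theta> where "\<theta> = (if x' = x then \<phi> else Inst x' x \<phi>)"
    have "is_formula L \<theta>" "fvars \<theta> \<subseteq> {x}"
      using \<phi> by (auto simp: \<theta>_def fvars_Inst)
    moreover have "a \<in> S \<longleftrightarrow> sat M (\<lambda>_. a) \<theta>" if "a \<in> carrier M" for a
    proof -
      have "sat M (assign [x'] [a]) \<phi> = sat M (\<lambda>_. a) \<phi>" "sat M ((\<lambda>_. a)(x' := a)) \<phi> = sat M (\<lambda>_. a) \<phi>"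
        using \<phi>(2) by (auto intro!: sat_cong)
      then show ?thesis using that by (auto simp: S \<theta>_def sat_Inst)
    qed
    ultimately have "determined_by L lt M x {\<theta>} {} S"
      by (simp add: determined_by_def same_type_def)
    then show ?case by blast
  qed
next
  case (compl S)
  then obtain \<Theta> \<J> where det: "determined_by L lt M x \<Theta> \<J> S"
    by blast
  have "determined_by L lt M x (\<Theta> \<union> \<Theta>) (\<J> \<union> \<J>) (carrier M - S)"
    by (rule determined_by_Un[OF det det]) blast
  then show ?case by blast
next
  case (union S S')
  then obtain \<Theta> \<J> \<Theta>' \<J>' where "determined_by L lt M x \<Theta> \<J> S" "determined_by L lt M x \<Theta>' \<J>' S'"
    by blast
  then have "determined_by L lt M x (\<Theta> \<union> \<Theta>') (\<J> \<union> \<J>') (S \<union> S')"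
    by (rule determined_by_Un) blast
  then show ?case by blast
next
  case (inter S S')
  then obtain \<Theta> \<J> \<Theta>' \<J>' where "determined_by L lt M x \<Theta> \<J> S" "determined_by L lt M x \<Theta>' \<J>' S'"
    by blast
  then have "determined_by L lt M x (\<Theta> \<union> \<Theta>') (\<J> \<union> \<J>') (S \<inter> S')"
    by (rule determined_by_Un) blast
  then show ?case by blast
qed

text \<open>The type is given by a reference point \<open>w\<close> and not by a list of true
  formulas: in the compactness argument one \<open>w\<close> then fixes compatible types for all
  \<Theta> at once.\<close>

definition Same_type :: "nat \<Rightarrow> nat \<Rightarrow> ('f, 'r) fm set \<Rightarrow> ('f, 'r) fm" where
  "Same_type x w \<Theta> =
     Conjs ((\<lambda>\<theta>. Conj (Imp \<theta> (Inst x w \<theta>)) (Imp (Inst x w \<theta>) \<theta>)) ` \<Theta>)"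

lemma is_formula_Same_type:
  "finite \<Theta> \<Longrightarrow> is_formula L (Same_type x w \<Theta>) \<longleftrightarrow> (\<forall>\<theta>\<in>\<Theta>. is_formula L \<theta>)"
  by (simp add: Same_type_def is_formula_Conjs)

lemma fvars_Same_type:
  assumes "finite \<Theta>" "\<And>\<theta>. \<theta> \<in> \<Theta> \<Longrightarrow> fvars \<theta> \<subseteq> {x}" "x \<noteq> w"
  shows "fvars (Same_type x w \<Theta>) \<subseteq> {x, w}"
proof -
  have "fvars (Inst x w \<theta>) \<subseteq> {x, w}" "fvars \<theta> \<subseteq> {x, w}" if "\<theta> \<in> \<Theta>" for \<theta>
    using assms(2)[OF that] assms(3) by (auto simp: fvars_Inst)
  then show ?thesis
    using assms(1) by (simp add: Same_type_def fvars_Conjs UN_subset_iff)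
qed

lemma sat_Same_type:
  assumes "finite \<Theta>" "\<And>\<theta>. \<theta> \<in> \<Theta> \<Longrightarrow> fvars \<theta> \<subseteq> {x}" "x \<noteq> w" "e w \<in> carrier M"
  shows "sat M (e(x := a)) (Same_type x w \<Theta>) \<longleftrightarrow> same_type M \<Theta> (e w) a"
proof -
  have "sat M (e(x := a)) (Inst x w \<theta>) = sat M (\<lambda>_. e w) \<theta>"
    "sat M (e(x := a)) \<theta> = sat M (\<lambda>_. a) \<theta>" if "\<theta> \<in> \<Theta>" for \<theta>
    using assms(2)[OF that] assms(3,4) by (simp_all add: sat_Inst sat_one_variable)
  then show ?thesis
    using assms(1) unfolding Same_type_def same_type_def by (auto simp: sat_Conjs)
qed

lemma sat_Exists_Alternation:
  assumes \<Theta>: "finite \<Theta>" "\<And>\<theta>. \<theta> \<in> \<Theta> \<Longrightarrow> fvars \<theta> \<subseteq> {x}"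
    and fresh: "x \<noteq> w" "x \<noteq> z" "w \<noteq> z" "z \<notin> fvars \<phi>" and "e w \<in> carrier M"
  shows "sat M e (Exists x (Alternation lt x z (Same_type x w \<Theta>) \<phi> n)) \<longleftrightarrow>
    (\<exists>a. alternation (\<lambda>a b. rint M lt [a, b]) {a \<in> carrier M. same_type M \<Theta> (e w) a}
       {a \<in> carrier M. sat M (e(x := a)) \<phi>} n a)"
proof -
  have "z \<notin> fvars (Same_type x w \<Theta>)"
    using fvars_Same_type[OF \<Theta> fresh(1)] fresh by auto
  then have "sat M e (Exists x (Alternation lt x z (Same_type x w \<Theta>) \<phi> n)) \<longleftrightarrow>
      (\<exists>a\<in>carrier M. alternation (\<lambda>a b. rint M lt [a, b])
        {a \<in> carrier M. sat M (e(x := a)) (Same_type x w \<Theta>)} {a \<in> carrier M. sat M (e(x := a)) \<phi>} n a)"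
    using fresh by (simp add: sat_Alternation)
  also have "{a \<in> carrier M. sat M (e(x := a)) (Same_type x w \<Theta>)} =
      {a \<in> carrier M. same_type M \<Theta> (e w) a}"
    using sat_Same_type[where e = e and M = M, OF \<Theta> fresh(1) assms(7)] by simp
  finally show ?thesis using alternation_in by fastforce
qed

text \<open>If no \<Theta> and \<open>n\<close> worked, then \<open>T\<close> together with all
  formulas \<open>A (\<Theta>, n)\<close>, in which \<open>w\<close> and \<open>ys\<close> act as
  new constants, would be finitely satisfiable in \<open>'v\<close>, hence satisfied in
  \<open>'u\<close>. There the set defined by \<phi> is determined by some finite \<Theta> and \<J>,
  which bounds its alternations on the \<Theta>-type of \<open>w\<close>.\<close>

theorem uniformly_bounded_alternation:
  fixes L :: "('f, 'r) lang"
  assumes large: "large_universe TYPE('u) L"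
    and lt: "lt \<in> rsyms L" "rarity L lt = 2" and T: "is_theory L T"
    and extends: "extends TYPE('u) L T (infinite_linear_orderings lt)"
    and wqom: "weakly_quasi_o_minimal TYPE('u) L lt T"
    and \<phi>: "is_formula L \<phi>" "fvars \<phi> \<subseteq> insert x (set ys)" "distinct (x # ys)"
  shows "\<exists>\<Theta> n. finite \<Theta> \<and> (\<forall>\<theta>\<in>\<Theta>. is_formula L \<theta> \<and> fvars \<theta> \<subseteq> {x}) \<and>
    (\<forall>(M :: ('f, 'r, 'v) struct) e w a. is_model L T M \<longrightarrow> e ` set ys \<subseteq> carrier M \<longrightarrow> w \<in> carrier M \<longrightarrow>
       \<not> alternation (\<lambda>a b. rint M lt [a, b]) {a \<in> carrier M. same_type M \<Theta> w a}
          {a \<in> carrier M. sat M (e(x := a)) \<phi>} n a)"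
proof (rule ccontr)
  define bounded where "bounded \<Theta> n \<longleftrightarrow>
    (\<forall>(M :: ('f, 'r, 'v) struct) e w a. is_model L T M \<longrightarrow> e ` set ys \<subseteq> carrier M \<longrightarrow> w \<in> carrier M \<longrightarrow>
       \<not> alternation (\<lambda>a b. rint M lt [a, b]) {a \<in> carrier M. same_type M \<Theta> w a}
          {a \<in> carrier M. sat M (e(x := a)) \<phi>} n a)" for \<Theta> n
  define one where "one \<Theta> \<longleftrightarrow> finite \<Theta> \<and> (\<forall>\<theta>\<in>\<Theta>. is_formula L \<theta> \<and> fvars \<theta> \<subseteq> {x})" for \<Theta>
  assume "\<not> ?thesis"
  then have unbounded: "\<not> bounded \<Theta> n" if "one \<Theta>" for \<Theta> n
    using that unfolding one_def bounded_def by blast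
  obtain w z :: nat where fresh: "w \<notin> insert x (set ys)" "z \<notin> insert w (insert x (set ys))"
    using ex_new_if_finite[of "insert x (set ys)"] ex_new_if_finite[of "insert _ (insert x (set ys))"]
    by (metis List.finite_set finite_insert infinite_UNIV_nat)
  define A where "A = (\<lambda>(\<Theta>, n). Exists x (Alternation lt x z (Same_type x w \<Theta>) \<phi> n))"
  have A_formula: "is_formula L (A (\<Theta>, n))" if "one \<Theta>" for \<Theta> n
    using that lt \<phi>(1) by (auto simp: A_def one_def is_formula_Same_type intro!: is_formula_Alternation)
  have sat_A: "sat M e (A (\<Theta>, n)) \<longleftrightarrow>
      (\<exists>a. alternation (\<lambda>a b. rint M lt [a, b]) {a \<in> carrier M. same_type M \<Theta> (e w) a}
          {a \<in> carrier M. sat M (e(x := a)) \<phi>} n a)"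
    if "one \<Theta>" "e w \<in> carrier M" for \<Theta> n e and M :: "('f, 'r, 'v) struct"
    unfolding A_def case_prod_conv
    by (rule sat_Exists_Alternation) (use that fresh \<phi>(2) in \<open>auto simp: one_def\<close>)
  \<comment> \<open>The same equivalence for the other universe: a local fact is not polymorphic in
    the type of elements.\<close>
  have sat_A': "sat N e (A (\<Theta>, n)) \<longleftrightarrow>
      (\<exists>a. alternation (\<lambda>a b. rint N lt [a, b]) {a \<in> carrier N. same_type N \<Theta> (e w) a}
          {a \<in> carrier N. sat N (e(x := a)) \<phi>} n a)"
    if "one \<Theta>" "e w \<in> carrier N" for \<Theta> n e and N :: "('f, 'r, 'u) struct"
    unfolding A_def case_prod_conv
    by (rule sat_Exists_Alternation) (use that fresh \<phi>(2) in \<open>auto simp: one_def\<close>)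
  define \<Gamma> where "\<Gamma> = T \<union> A ` ({\<Theta>. one \<Theta>} \<times> UNIV)"
  have "\<exists>(N :: ('f, 'r, 'u) struct) e.
      is_structure L N \<and> range e \<subseteq> carrier N \<and> (\<forall>\<gamma>\<in>\<Gamma>. sat N e \<gamma>)"
  proof (rule compactness[OF large])
    show "is_formula L \<gamma>" if "\<gamma> \<in> \<Gamma>" for \<gamma>
      using that T A_formula unfolding \<Gamma>_def is_theory_def by auto
    fix \<Gamma>' assume "finite \<Gamma>'" "\<Gamma>' \<subseteq> \<Gamma>"
    then have "finite (\<Gamma>' - T)" "\<Gamma>' - T \<subseteq> A ` ({\<Theta>. one \<Theta>} \<times> UNIV)"
      unfolding \<Gamma>_def by auto
    then obtain P where P: "finite P" "P \<subseteq> {\<Theta>. one \<Theta>} \<times> UNIV" "\<Gamma>' - T = A ` P"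
      by (metis finite_subset_image)
    \<comment> \<open>One pair dominates all of \<open>P\<close>: a larger \<Theta> has smaller
      realisation sets, and a longer alternation can be cut down. The inserted 0 covers empty
      \<open>P\<close>.\<close>
    define \<Theta>' n' where "\<Theta>' = \<Union> (fst ` P)" and "n' = Max (insert 0 (snd ` P))"
    have P_one: "one \<Theta>" if "(\<Theta>, n) \<in> P" for \<Theta> n
      using P(2) that by blast
    have "finite \<Theta>'"
      using P(1) P_one unfolding one_def \<Theta>'_def by auto
    moreover have "is_formula L \<theta> \<and> fvars \<theta> \<subseteq> {x}" if \<theta>: "\<theta> \<in> \<Theta>'" for \<theta>
    proof -
      obtain \<Theta> n where "(\<Theta>, n) \<in> P" "\<theta> \<in> \<Theta>" using \<theta> by (auto simp: \<Theta>'_def)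
      then show ?thesis using P_one unfolding one_def by blast
    qed
    ultimately have "one \<Theta>'" unfolding one_def by blast
    then obtain M :: "('f, 'r, 'v) struct" and e w0 a where M: "is_model L T M"
      and e: "e ` set ys \<subseteq> carrier M" "w0 \<in> carrier M"
      and a: "alternation (\<lambda>a b. rint M lt [a, b]) {a \<in> carrier M. same_type M \<Theta>' w0 a}
          {a \<in> carrier M. sat M (e(x := a)) \<phi>} n' a"
      using unbounded unfolding bounded_def by blast
    \<comment> \<open>Sending every other variable to \<open>w0\<close> both gives \<open>w\<close>
      its reference point and makes the whole assignment take values in the carrier.\<close>
    define e' where "e' v = (if v \<in> set ys then e v else w0)" for v
    have e': "range e' \<subseteq> carrier M" "e' w = w0"
      using e fresh by (auto simp: e'_def)
    have \<phi>_e': "sat M (e'(x := a)) \<phi> = sat M (e(x := a)) \<phi>" for a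
      using \<phi>(2) by (intro sat_cong) (auto simp: e'_def)
    have "sat M e' (A (\<Theta>, n))" if "(\<Theta>, n) \<in> P" for \<Theta> n
    proof -
      have "n \<le> n'" unfolding n'_def using P(1) that by (force intro: Max_ge)
      then obtain b where b: "alternation (\<lambda>a b. rint M lt [a, b])
          {a \<in> carrier M. same_type M \<Theta>' w0 a} {a \<in> carrier M. sat M (e(x := a)) \<phi>} n b"
        using alternation_shorter[OF a] by blast
      have "{a \<in> carrier M. same_type M \<Theta>' w0 a} \<subseteq> {a \<in> carrier M. same_type M \<Theta> w0 a}"
        using that unfolding \<Theta>'_def same_type_def by fastforce
      then have "alternation (\<lambda>a b. rint M lt [a, b])
          {a \<in> carrier M. same_type M \<Theta> w0 a} {a \<in> carrier M. sat M (e(x := a)) \<phi>} n b"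
        using b by (rule alternation_mono)
      then show ?thesis
        using P_one[OF that] e' e(2) by (subst sat_A) (auto simp: \<phi>_e')
    qed
    then have "sat M e' \<gamma>" if "\<gamma> \<in> \<Gamma>'" for \<gamma>
    proof (cases "\<gamma> \<in> T")
      case True
      then show ?thesis using M e' unfolding is_model_def valid_in_def by blast
    next
      case False
      then have "\<gamma> \<in> A ` P" using that P(3) by blast
      then show ?thesis using \<open>\<And>\<Theta> n. (\<Theta>, n) \<in> P \<Longrightarrow> sat M e' (A (\<Theta>, n))\<close> by auto
    qed
    then show "\<exists>(M :: ('f, 'r, 'v) struct) e. is_structure L M \<and> range e \<subseteq> carrier M \<and>
        (\<forall>\<gamma>\<in>\<Gamma>'. sat M e \<gamma>)"
      using M e' unfolding is_model_def by blast
  qed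
  then obtain N :: "('f, 'r, 'u) struct" and e where N: "is_structure L N" "range e \<subseteq> carrier N"
    and sat: "\<And>\<gamma>. \<gamma> \<in> \<Gamma> \<Longrightarrow> sat N e \<gamma>" by blast
  have "valid_in N \<sigma>" if "\<sigma> \<in> T" for \<sigma>
    using that T sat[of \<sigma>] sentence_valid_iff[OF _ N(2)] unfolding is_theory_def \<Gamma>_def by blast
  then have model: "is_model L T N"
    using N(1) unfolding is_model_def by blast
  let ?D = "{a \<in> carrier N. sat N (e(x := a)) \<phi>}"
  let ?R = "\<lambda>a b. rint N lt [a, b]"
  have "sat N (assign (x # ys) (a # map e ys)) \<phi> = sat N (e(x := a)) \<phi>" for a
    using \<phi>(2) by (intro sat_cong) (auto simp: assign_map)
  then have "definable_over L N (carrier N) ?D"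
    unfolding definable_over_def using \<phi> N(2)
    by (intro exI[of _ \<phi>] exI[of _ x] exI[of _ ys] exI[of _ "map e ys"]) auto
  then have "?D \<in> boolean_combinations (carrier N)
      ({C. convex_in lt N C} \<union> {E. definable_over L N {} E})"
    using wqom model unfolding weakly_quasi_o_minimal_def by blast
  then have "\<exists>\<Theta> \<J>. determined_by L lt N x \<Theta> \<J> ?D"
    by (rule boolean_combination_determined[OF model_linear_on[OF large lt T extends model]])
  then obtain \<Theta> \<J> where det: "determined_by L lt N x \<Theta> \<J> ?D"
    by blast
  then have "one \<Theta>" unfolding one_def determined_by_def by blast
  moreover have "e w \<in> carrier N" using N(2) by blast
  \<comment> \<open>The index \<open>Suc (card \<J>)\<close> is just beyond what the segments in
    \<J> permit.\<close>
  ultimately obtain a where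
    a: "alternation ?R {a \<in> carrier N. same_type N \<Theta> (e w) a} ?D (Suc (card \<J>)) a"
    using sat[of "A (\<Theta>, Suc (card \<J>))"] sat_A' unfolding \<Gamma>_def by blast
  have "card {J \<in> \<J>. a \<in> J} + Suc (card \<J>) \<le> card \<J>"
  proof (rule alternation_length_bound[OF _ _ _ _ a])
    show "finite \<J>" using det by (simp add: determined_by_def)
    show "initial_in (carrier N) ?R J" if "J \<in> \<J>" for J
      using det that by (simp add: determined_by_def)
    fix b c
    assume "b \<in> {a \<in> carrier N. same_type N \<Theta> (e w) a}" "c \<in> {a \<in> carrier N. same_type N \<Theta> (e w) a}"
      and "\<forall>J\<in>\<J>. b \<in> J \<longleftrightarrow> c \<in> J"
    moreover from this have "same_type N \<Theta> b c" by (simp add: same_type_def)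
    ultimately show "b \<in> ?D \<longleftrightarrow> c \<in> ?D"
      using det unfolding determined_by_def by blast
  qed auto
  then show False by simp
qed

section \<open>Uniform definitions with one parameter\<close>

text \<open>In contrast to \<open>Same_type\<close>, the type is given by the set \<open>S\<close>
  of its true formulas: a uniform definition has no variable for \<open>a\<close>, but
  \<open>S\<close> ranges over finitely many sets and can go into the index.\<close>

definition Has_type :: "('f, 'r) fm set \<Rightarrow> ('f, 'r) fm set \<Rightarrow> ('f, 'r) fm" where
  "Has_type \<Theta> S = Conjs (S \<union> Neg ` (\<Theta> - S))"

definition Before :: "'r \<Rightarrow> nat \<Rightarrow> nat \<Rightarrow> ('f, 'r) fm \<Rightarrow> ('f, 'r) fm \<Rightarrow> nat \<Rightarrow> ('f, 'r) fm" where
  "Before lt x z \<kappa> \<phi> k = Neg (At_or_below lt x z (Alternation lt x z \<kappa> \<phi> k))"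

lemma sat_Has_type:
  assumes "finite \<Theta>" "\<And>\<theta>. \<theta> \<in> \<Theta> \<Longrightarrow> fvars \<theta> \<subseteq> {x}" "S = {\<theta> \<in> \<Theta>. sat M (\<lambda>_. w) \<theta>}"
  shows "sat M (e(x := a)) (Has_type \<Theta> S) \<longleftrightarrow> same_type M \<Theta> w a"
proof -
  have "sat M (e(x := a)) \<theta> = sat M (\<lambda>_. a) \<theta>" if "\<theta> \<in> \<Theta>" for \<theta>
    using assms(2)[OF that] by (rule sat_one_variable)
  moreover have "finite S" using assms(1,3) by simp
  then have "sat M (e(x := a)) (Has_type \<Theta> S) \<longleftrightarrow>
      (\<forall>\<theta>\<in>S. sat M (e(x := a)) \<theta>) \<and> (\<forall>\<theta>\<in>\<Theta> - S. \<not> sat M (e(x := a)) \<theta>)"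
    using assms(1) by (simp add: Has_type_def sat_Conjs ball_Un)
  ultimately show ?thesis
    unfolding same_type_def assms(3) by auto
qed

lemma is_formula_Has_type:
  assumes "finite \<Theta>" "\<And>\<theta>. \<theta> \<in> \<Theta> \<Longrightarrow> is_formula L \<theta>" "S \<subseteq> \<Theta>"
  shows "is_formula L (Has_type \<Theta> S)"
proof -
  have "finite S" using assms(1,3) by (rule rev_finite_subset)
  then show ?thesis
    using assms(1) assms(2) assms(3) by (auto simp: Has_type_def is_formula_Conjs)
qed

lemma fvars_Has_type:
  assumes "finite \<Theta>" "\<And>\<theta>. \<theta> \<in> \<Theta> \<Longrightarrow> fvars \<theta> \<subseteq> {x}" "S \<subseteq> \<Theta>"
  shows "fvars (Has_type \<Theta> S) \<subseteq> {x}"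
proof -
  have "finite S" using assms(1,3) by (rule rev_finite_subset)
  then have "fvars (Has_type \<Theta> S) = (\<Union>\<theta>\<in>S. fvars \<theta>) \<union> (\<Union>\<theta>\<in>\<Theta> - S. fvars \<theta>)"
    using assms(1) by (auto simp: Has_type_def fvars_Conjs)
  then show ?thesis using assms(2,3) by blast
qed

lemma is_formula_Before:
  assumes "lt \<in> rsyms L" "rarity L lt = 2" "is_formula L \<kappa>" "is_formula L \<phi>"
  shows "is_formula L (Before lt x z \<kappa> \<phi> k)"
  using assms by (simp add: Before_def is_formula_At_or_below is_formula_Alternation)

lemma fvars_Before:
  assumes "x \<noteq> z"
  shows "fvars (Before lt x z \<kappa> \<phi> k) \<subseteq> insert x (fvars \<kappa> \<union> fvars \<phi>)"
  using fvars_Alternation[OF assms, of lt \<kappa> \<phi> k] assms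
  by (auto simp: Before_def fvars_At_or_below)

lemma sat_Before:
  assumes "x \<noteq> z" "z \<notin> fvars \<kappa>" "z \<notin> fvars \<phi>" "a \<in> carrier M"
  shows "sat M (e(x := a)) (Before lt x z \<kappa> \<phi> k) \<longleftrightarrow>
    a \<in> before_alternation (carrier M) (\<lambda>a b. rint M lt [a, b])
      {a \<in> carrier M. sat M (e(x := a)) \<kappa>} {a \<in> carrier M. sat M (e(x := a)) \<phi>} k"
proof -
  define alt where "alt = alternation (\<lambda>a b. rint M lt [a, b])
    {a \<in> carrier M. sat M (e(x := a)) \<kappa>} {a \<in> carrier M. sat M (e(x := a)) \<phi>} k"
  have alt: "sat M (e(x := b)) (Alternation lt x z \<kappa> \<phi> k) \<longleftrightarrow> alt b" if "b \<in> carrier M" for b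
    unfolding alt_def by (rule sat_Alternation[OF assms(1-3) that])
  have in_carrier: "b \<in> carrier M" if "alt b" for b
    using alternation_in[OF that[unfolded alt_def]] by blast
  have "z \<notin> fvars (Alternation lt x z \<kappa> \<phi> k)"
    using assms(1-3) fvars_Alternation by fastforce
  then have "sat M (e(x := a)) (Before lt x z \<kappa> \<phi> k) \<longleftrightarrow>
      \<not> (\<exists>b\<in>carrier M. (rint M lt [b, a] \<or> b = a) \<and> sat M (e(x := b)) (Alternation lt x z \<kappa> \<phi> k))"
    using assms(1) by (simp add: Before_def sat_At_or_below)
  also have "\<dots> \<longleftrightarrow> \<not> (\<exists>b. (rint M lt [b, a] \<or> b = a) \<and> alt b)"
    using alt in_carrier by blast
  finally show ?thesis
    using assms(4) unfolding before_alternation_def alt_def by blast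
qed

text \<open>The official index set consists of natural numbers; a bijection lets the actual
  construction use structured indices.\<close>

lemma uniform_definition_reindex:
  fixes F :: "'i \<Rightarrow> ('f, 'r) fm \<Rightarrow> ('f, 'r) fm"
  assumes "finite I" "length zs = length ys" "distinct (ys @ zs)"
    and formulas: "\<And>i \<phi>. i \<in> I \<Longrightarrow> \<phi> \<in> \<Delta> \<Longrightarrow> is_formula L (F i \<phi>) \<and> fvars (F i \<phi>) \<subseteq> set (ys @ zs)"
    and types: "\<And>B a. finite B \<Longrightarrow> B \<noteq> {} \<Longrightarrow>
      (\<And>b. b \<in> B \<Longrightarrow> length b = length ys \<and> set b \<subseteq> carrier M) \<Longrightarrow> a \<in> carrier M \<Longrightarrow>
      \<exists>b\<^sub>0\<in>B. \<exists>i\<in>I. \<forall>\<phi>\<in>\<Delta>. \<forall>b\<in>B. sat M ((assign ys b)(x := a)) \<phi> \<longleftrightarrow>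
        sat M (assign (ys @ zs) (b @ b\<^sub>0)) (F i \<phi>)"
  shows "\<exists>zss I F. uniform_definition L M [x] ys \<Delta> 1 zss I F"
proof -
  obtain h where h: "bij_betw h {0..<card I} I"
    using ex_bij_betw_nat_finite[OF assms(1)] by blast
  have "uniform_definition L M [x] ys \<Delta> 1 [zs] {0..<card I} (\<lambda>i. F (h i))"
    unfolding uniform_definition_def
  proof (intro conjI allI impI ballI)
    fix i \<phi> assume "i \<in> {0..<card I}" "\<phi> \<in> \<Delta>"
    then have "is_formula L (F (h i) \<phi>) \<and> fvars (F (h i) \<phi>) \<subseteq> set (ys @ zs)"
      using h by (intro formulas) (auto dest: bij_betwE)
    then show "is_formula L (F (h i) \<phi>)" "fvars (F (h i) \<phi>) \<subseteq> set (ys @ concat [zs])"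
      by auto
  next
    fix B as
    assume "finite B \<and> B \<noteq> {} \<and> (\<forall>b\<in>B. length b = length ys \<and> set b \<subseteq> carrier M) \<and>
      length as = length [x] \<and> set as \<subseteq> carrier M"
    then obtain a where B: "finite B" "B \<noteq> {}"
        "\<And>b. b \<in> B \<Longrightarrow> length b = length ys \<and> set b \<subseteq> carrier M"
      and a: "as = [a]" "a \<in> carrier M"
      by (auto simp: length_Suc_conv)
    obtain b\<^sub>0 i where "b\<^sub>0 \<in> B" "i \<in> I" and i: "\<forall>\<phi>\<in>\<Delta>. \<forall>b\<in>B.
        sat M ((assign ys b)(x := a)) \<phi> \<longleftrightarrow> sat M (assign (ys @ zs) (b @ b\<^sub>0)) (F i \<phi>)"
      using types[OF B a(2)] by blast
    moreover have "i \<in> h ` {0..<card I}"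
      using bij_betw_imp_surj_on[OF h] \<open>i \<in> I\<close> by simp
    then obtain j where "j \<in> {0..<card I}" "h j = i" by auto
    ultimately show "\<exists>bs. length bs = 1 \<and> set bs \<subseteq> B \<and> (\<exists>i\<in>{0..<card I}. \<forall>\<phi>\<in>\<Delta>. \<forall>b\<in>B.
        sat M (assign ([x] @ ys) (as @ b)) \<phi> \<longleftrightarrow>
        sat M (assign (ys @ concat [zs]) (b @ concat bs)) (F (h i) \<phi>))"
      using a(1) by (intro exI[of _ "[b\<^sub>0]"] conjI bexI[of _ j]) auto
  qed (use assms(1-3) in auto)
  then show ?thesis by blast
qed

text \<open>An index consists of the \<Theta>-type of \<open>a\<close> and of the formula and
  alternation number of the least segment containing \<open>a\<close>; only the tuple
  \<open>b\<^sub>0\<close> of that segment is a parameter. The index \<open>None\<close> stands for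
  an \<open>a\<close> outside all segments, and then any element of \<open>B\<close> serves as the
  parameter.\<close>

lemma one_parameter_definition:
  fixes M :: "('f, 'r, 'u) struct"
  assumes lt: "lt \<in> rsyms L" "rarity L lt = 2"
    and linear: "linear_on (carrier M) (\<lambda>a b. rint M lt [a, b])"
    and \<Delta>: "partitioned_formulas L [x] ys \<Delta>" "finite \<Delta>"
    and \<Theta>: "finite \<Theta>" "\<And>\<theta>. \<theta> \<in> \<Theta> \<Longrightarrow> is_formula L \<theta>" "\<And>\<theta>. \<theta> \<in> \<Theta> \<Longrightarrow> fvars \<theta> \<subseteq> {x}"
    and bound: "\<And>\<phi> e w a. \<phi> \<in> \<Delta> \<Longrightarrow> e ` set ys \<subseteq> carrier M \<Longrightarrow> w \<in> carrier M \<Longrightarrow>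
      \<not> alternation (\<lambda>a b. rint M lt [a, b]) {a \<in> carrier M. same_type M \<Theta> w a}
        {a \<in> carrier M. sat M (e(x := a)) \<phi>} n a"
  shows "\<exists>zss I F. uniform_definition L M [x] ys \<Delta> 1 zss I F"
proof -
  let ?R = "\<lambda>a b. rint M lt [a, b]"
  have ys: "x \<notin> set ys" "distinct ys"
    and \<Delta>_formula: "\<And>\<phi>. \<phi> \<in> \<Delta> \<Longrightarrow> is_formula L \<phi>"
    and \<Delta>_fvars: "\<And>\<phi>. \<phi> \<in> \<Delta> \<Longrightarrow> fvars \<phi> \<subseteq> insert x (set ys)"
    using \<Delta>(1) unfolding partitioned_formulas_def by auto
  obtain z where z: "\<And>v. v \<in> insert x (set ys) \<Longrightarrow> v < z"
    using finite_nat_set_iff_bounded[of "insert x (set ys)"] by auto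
  \<comment> \<open>The list starts at \<open>Suc z\<close> because \<open>z\<close> itself is
    reserved as the bound variable of the alternation formulas.\<close>
  define zs where "zs = [Suc z..<Suc z + length ys]"
  have "v \<notin> set zs" if "v \<in> insert x (set ys)" for v
    using z[OF that] by (simp add: zs_def)
  then have zs: "length zs = length ys" "distinct zs" "x \<notin> set zs" "set ys \<inter> set zs = {}"
    by (auto simp: zs_def simp del: upt_Suc)
  have xz: "x \<noteq> z" using z by blast
  define \<kappa> where "\<kappa> S = Has_type \<Theta> S" for S
  \<comment> \<open>Membership of \<open>a\<close> is replaced by an inclusion of segments: the
    recorded one, with its parameters moved from \<open>ys\<close> to \<open>zs\<close>, is
    contained in the one of \<phi>, \<open>k\<close> and \<open>ys\<close>. Quantifying over
    \<open>x\<close> removes the last trace of \<open>a\<close>.\<close>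
  define Member where "Member S j \<phi> k = (case j of
      None \<Rightarrow> Fls
    | Some (\<phi>', k') \<Rightarrow> Forall x (Imp (Insts ys zs (Before lt x z (\<kappa> S) \<phi>' k')) (Before lt x z (\<kappa> S) \<phi> k)))"
    for S j \<phi> k
  \<comment> \<open>The disjunction over even \<open>k\<close> from
    \<open>in_iff_before_alternation\<close>, written by De Morgan with the available
    conjunction.\<close>
  define F where "F i \<phi> = Neg (Conjs ((\<lambda>k. Neg (Conj (Neg (Member (fst i) (snd i) \<phi> k))
      (Member (fst i) (snd i) \<phi> (Suc k)))) ` {k. k < n \<and> even k}))" for i \<phi>
  \<comment> \<open>The value \<open>n\<close> is included, since \<open>F\<close> compares
    \<open>k\<close> with \<open>Suc k\<close> for \<open>k < n\<close>.\<close>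
  define I where "I = Pow \<Theta> \<times> insert None (Some ` (\<Delta> \<times> {..n}))"
  have \<kappa>: "is_formula L (\<kappa> S)" "fvars (\<kappa> S) \<subseteq> {x}" if "S \<subseteq> \<Theta>" for S
    using \<Theta> that unfolding \<kappa>_def by (auto intro: is_formula_Has_type dest: fvars_Has_type)
  have Before: "is_formula L (Before lt x z (\<kappa> S) \<phi> k)"
    "fvars (Before lt x z (\<kappa> S) \<phi> k) \<subseteq> insert x (set ys)" if "S \<subseteq> \<Theta>" "\<phi> \<in> \<Delta>" for S \<phi> k
    using is_formula_Before[OF lt \<kappa>(1)[OF that(1)] \<Delta>_formula[OF that(2)]]
      fvars_Before[OF xz, of lt "\<kappa> S" \<phi> k] \<kappa>(2)[OF that(1)] \<Delta>_fvars[OF that(2)] by blast+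
  have Member: "is_formula L (Member S j \<phi> k)" "fvars (Member S j \<phi> k) \<subseteq> set (ys @ zs)"
    if S: "S \<subseteq> \<Theta>" and j: "j \<in> insert None (Some ` (\<Delta> \<times> {..n}))" and \<phi>: "\<phi> \<in> \<Delta>" for S j \<phi> k
  proof -
    consider "j = None" | \<phi>' k' where "j = Some (\<phi>', k')" "\<phi>' \<in> \<Delta>" using j by auto
    then have "is_formula L (Member S j \<phi> k) \<and> fvars (Member S j \<phi> k) \<subseteq> set (ys @ zs)"
    proof cases
      case 1
      then show ?thesis by (simp add: Member_def)
    next
      case (2 \<phi>' k')
      then show ?thesis
        using Before[OF S \<phi>, of k] Before[OF S 2(2), of k']
          fvars_Insts[OF zs(1,4), of "Before lt x z (\<kappa> S) \<phi>' k'"]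
        by (auto simp: Member_def)
    qed
    then show "is_formula L (Member S j \<phi> k)" "fvars (Member S j \<phi> k) \<subseteq> set (ys @ zs)" by auto
  qed
  show ?thesis
  proof (rule uniform_definition_reindex)
    show "finite I" unfolding I_def using \<Theta>(1) \<Delta>(2) by simp
    show "length zs = length ys" by (fact zs)
    show "distinct (ys @ zs)" using ys(2) zs(2,4) by simp
    show "is_formula L (F i \<phi>) \<and> fvars (F i \<phi>) \<subseteq> set (ys @ zs)" if "i \<in> I" "\<phi> \<in> \<Delta>" for i \<phi>
    proof -
      have "fst i \<subseteq> \<Theta>" "snd i \<in> insert None (Some ` (\<Delta> \<times> {..n}))"
        using that(1) by (auto simp: I_def)
      note Member[OF this that(2)]
      then show ?thesis
        unfolding F_def by (simp add: is_formula_Conjs fvars_Conjs UN_subset_iff)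
    qed
    fix B a
    assume B: "finite B" "B \<noteq> {}" "\<And>b. b \<in> B \<Longrightarrow> length b = length ys \<and> set b \<subseteq> carrier M"
      and a: "a \<in> carrier M"
    define S where "S = {\<theta> \<in> \<Theta>. sat M (\<lambda>_. a) \<theta>}"
    define K where "K = {c \<in> carrier M. same_type M \<Theta> a c}"
    define D where "D \<phi> b = {c \<in> carrier M. sat M ((assign ys b)(x := c)) \<phi>}" for \<phi> b
    define J where "J = (\<lambda>(\<phi>, k, b). before_alternation (carrier M) ?R K (D \<phi> b) k)"
    have S: "S \<subseteq> \<Theta>" by (auto simp: S_def)
    have K: "K \<subseteq> carrier M" "a \<in> K"
      using a by (auto simp: K_def same_type_def)
    have initial: "initial_in (carrier M) ?R (J i)" for i
      using initial_before_alternation[OF linear K(1)] by (simp add: J_def case_prod_unfold)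
    have sat_\<kappa>: "{c \<in> carrier M. sat M (e(x := c)) (\<kappa> S)} = K" for e
      using sat_Has_type[OF \<Theta>(1,3) S_def, of e] unfolding \<kappa>_def K_def by simp
    have sat_Before: "sat M ((assign ys b)(x := c)) (Before lt x z (\<kappa> S) \<phi> k) \<longleftrightarrow> c \<in> J (\<phi>, k, b)"
      if "\<phi> \<in> \<Delta>" "c \<in> carrier M" for \<phi> k b c
    proof -
      have "z \<notin> fvars (\<kappa> S)" "z \<notin> fvars \<phi>"
        using z xz \<kappa>(2)[OF S] \<Delta>_fvars[OF that(1)] by blast+
      from sat_Before[OF xz this that(2), of "assign ys b" lt k] show ?thesis
        unfolding sat_\<kappa> by (simp add: J_def D_def)
    qed
    have sat_Contains: "sat M (assign (ys @ zs) (b @ b\<^sub>0)) (Member S (Some (\<phi>', k')) \<phi> k) \<longleftrightarrow>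
        J (\<phi>', k', b\<^sub>0) \<subseteq> J (\<phi>, k, b)"
      if "\<phi> \<in> \<Delta>" "\<phi>' \<in> \<Delta>" "b \<in> B" "b\<^sub>0 \<in> B" for \<phi> \<phi>' k k' b b\<^sub>0
    proof -
      let ?e = "assign (ys @ zs) (b @ b\<^sub>0)"
      have len: "length b = length ys" "length b\<^sub>0 = length zs"
        and b\<^sub>0: "set b\<^sub>0 \<subseteq> carrier M"
        using B(3)[OF that(3)] B(3)[OF that(4)] zs(1) by auto
      have e_ys: "?e v = assign ys b v" if "v \<in> set ys" for v
        using that len(1) by (simp add: assign_append)
      have "map (assign zs b\<^sub>0) zs = b\<^sub>0"
        using len(2)[symmetric] zs(2) by (rule map_assign)
      moreover have "map ?e zs = map (assign zs b\<^sub>0) zs"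
        using len(1) zs(4) by (auto simp: assign_append)
      ultimately have e_zs: "map (?e(x := c)) zs = b\<^sub>0" for c
        using zs(3) by (simp add: map_fun_upd)
      have left: "sat M (?e(x := c)) (Insts ys zs (Before lt x z (\<kappa> S) \<phi>' k')) \<longleftrightarrow>
          c \<in> J (\<phi>', k', b\<^sub>0)" if c: "c \<in> carrier M" for c
      proof -
        have "(?e(x := c)) ` set zs \<subseteq> carrier M"
          using b\<^sub>0 e_zs[of c] by (metis list.set_map)
        from sat_Insts[OF zs(1,4) ys(2) this]
        have "sat M (?e(x := c)) (Insts ys zs (Before lt x z (\<kappa> S) \<phi>' k')) \<longleftrightarrow>
            sat M (\<lambda>v. if v \<in> set ys then assign ys b\<^sub>0 v else (?e(x := c)) v) (Before lt x z (\<kappa> S) \<phi>' k')"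
          unfolding e_zs .
        also have "\<dots> \<longleftrightarrow> sat M ((assign ys b\<^sub>0)(x := c)) (Before lt x z (\<kappa> S) \<phi>' k')"
          using Before(2)[OF S \<open>\<phi>' \<in> \<Delta>\<close>, of k'] ys(1) by (intro sat_cong) auto
        also have "\<dots> \<longleftrightarrow> c \<in> J (\<phi>', k', b\<^sub>0)"
          by (rule sat_Before[OF \<open>\<phi>' \<in> \<Delta>\<close> c])
        finally show ?thesis .
      qed
      have "sat M (?e(x := c)) (Before lt x z (\<kappa> S) \<phi> k) \<longleftrightarrow>
          sat M ((assign ys b)(x := c)) (Before lt x z (\<kappa> S) \<phi> k)" for c
        using Before(2)[OF S that(1), of k] e_ys by (intro sat_cong) auto
      then have right: "sat M (?e(x := c)) (Before lt x z (\<kappa> S) \<phi> k) \<longleftrightarrow> c \<in> J (\<phi>, k, b)"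
        if "c \<in> carrier M" for c
        using sat_Before[OF \<open>\<phi> \<in> \<Delta>\<close> that] by blast
      have "J (\<phi>', k', b\<^sub>0) \<subseteq> carrier M" by (auto simp: J_def before_alternation_def)
      then show ?thesis
        unfolding Member_def option.case prod.case sat.simps using left right by blast
    qed
    obtain j b\<^sub>0 where j: "j \<in> insert None (Some ` (\<Delta> \<times> {..n}))" "b\<^sub>0 \<in> B"
      and sat_Member: "\<And>\<phi> k b. \<phi> \<in> \<Delta> \<Longrightarrow> k \<le> n \<Longrightarrow> b \<in> B \<Longrightarrow>
        sat M (assign (ys @ zs) (b @ b\<^sub>0)) (Member S j \<phi> k) \<longleftrightarrow> a \<in> J (\<phi>, k, b)"
    proof (cases "\<exists>i \<in> \<Delta> \<times> {..n} \<times> B. a \<in> J i")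
      case True
      then have "\<exists>i \<in> \<Delta> \<times> {..n} \<times> B. \<forall>i' \<in> \<Delta> \<times> {..n} \<times> B. a \<in> J i' \<longleftrightarrow> J i \<subseteq> J i'"
        using initial_in_comparable[OF linear initial initial] \<Delta>(2) B(1)
        by (intro least_member_of_chain) auto
      then obtain \<phi>' k' b\<^sub>0 where i: "\<phi>' \<in> \<Delta>" "k' \<le> n" "b\<^sub>0 \<in> B"
        and least: "\<forall>i' \<in> \<Delta> \<times> {..n} \<times> B. a \<in> J i' \<longleftrightarrow> J (\<phi>', k', b\<^sub>0) \<subseteq> J i'"
        by auto
      show thesis
      proof (rule that[of "Some (\<phi>', k')" b\<^sub>0])
        show "sat M (assign (ys @ zs) (b @ b\<^sub>0)) (Member S (Some (\<phi>', k')) \<phi> k) \<longleftrightarrow> a \<in> J (\<phi>, k, b)"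
          if "\<phi> \<in> \<Delta>" "k \<le> n" "b \<in> B" for \<phi> k b
          using sat_Contains[OF that(1) i(1) that(3) i(3)] least that by auto
      qed (use i in auto)
    next
      case False
      obtain b\<^sub>0 where "b\<^sub>0 \<in> B" using B(2) by blast
      then show thesis
        using False by (intro that[of None b\<^sub>0]) (auto simp: Member_def)
    qed
    have "sat M ((assign ys b)(x := a)) \<phi> \<longleftrightarrow> sat M (assign (ys @ zs) (b @ b\<^sub>0)) (F (S, j) \<phi>)"
      if "\<phi> \<in> \<Delta>" "b \<in> B" for \<phi> b
    proof -
      have "assign ys b ` set ys \<subseteq> carrier M"
        using B(3)[OF that(2)] map_assign[of ys b] ys(2) by (metis list.set_map)
      then have "\<not> alternation ?R K (D \<phi> b) n c" for c
        using bound[OF that(1) _ a] unfolding K_def D_def by blast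
      then have "a \<in> D \<phi> b \<longleftrightarrow> (\<exists>k. k < n \<and> even k \<and> a \<notin> J (\<phi>, k, b) \<and> a \<in> J (\<phi>, Suc k, b))"
        unfolding J_def case_prod_conv by (rule in_iff_before_alternation[OF K])
      also have "\<dots> \<longleftrightarrow> sat M (assign (ys @ zs) (b @ b\<^sub>0)) (F (S, j) \<phi>)"
        using sat_Member[OF that(1) _ that(2)] unfolding F_def by (auto simp: sat_Conjs)
      finally show ?thesis using a by (simp add: D_def)
    qed
    moreover have "(S, j) \<in> I" using S j(1) by (simp add: I_def)
    ultimately show "\<exists>b\<^sub>0\<in>B. \<exists>i\<in>I. \<forall>\<phi>\<in>\<Delta>. \<forall>b\<in>B. sat M ((assign ys b)(x := a)) \<phi> \<longleftrightarrow>
        sat M (assign (ys @ zs) (b @ b\<^sub>0)) (F i \<phi>)"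
      using j(2) by blast
  qed
qed

theorem theorem6p8:
  fixes L :: "('f, 'r) lang" and lt :: 'r and T :: "('f, 'r) fm set"
  assumes "large_universe TYPE('u) L"
    and "lt \<in> rsyms L" and "rarity L lt = 2"
    and "is_theory L T"
    and "extends TYPE('u) L T (infinite_linear_orderings lt)"
    and "weakly_quasi_o_minimal TYPE('u) L lt T"
  shows "theory_VC_property TYPE('v) L T 1"
  unfolding theory_VC_property_def structure_VC_property_def
proof (intro allI impI)
  fix M :: "('f, 'r, 'v) struct" and xs ys \<Delta>
  assume M: "is_model L T M"
    and "partitioned_formulas L xs ys \<Delta> \<and> finite \<Delta> \<and> \<Delta> \<noteq> {} \<and> length xs = 1"
  then obtain x where xs: "xs = [x]" and \<Delta>: "partitioned_formulas L [x] ys \<Delta>" "finite \<Delta>"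
    by (auto simp: length_Suc_conv)
  let ?D = "\<lambda>e \<phi>. {a \<in> carrier M. sat M (e(x := a)) \<phi>}"
  define good where "good \<phi> \<Theta> n \<longleftrightarrow>
    finite \<Theta> \<and> (\<forall>\<theta>\<in>\<Theta>. is_formula L \<theta> \<and> fvars \<theta> \<subseteq> {x}) \<and>
    (\<forall>e w a. e ` set ys \<subseteq> carrier M \<longrightarrow> w \<in> carrier M \<longrightarrow>
       \<not> alternation (\<lambda>a b. rint M lt [a, b]) {a \<in> carrier M. same_type M \<Theta> w a} (?D e \<phi>) n a)"
    for \<phi> \<Theta> n
  have "\<exists>\<Theta> n. good \<phi> \<Theta> n" if "\<phi> \<in> \<Delta>" for \<phi>
  proof -
    have \<phi>: "is_formula L \<phi>" "fvars \<phi> \<subseteq> insert x (set ys)" "distinct (x # ys)"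
      using \<Delta>(1) that unfolding partitioned_formulas_def by auto
    from uniformly_bounded_alternation[OF assms this, where ?'v = 'v] M
    show ?thesis unfolding good_def by meson
  qed
  then obtain \<Theta> n where good: "\<And>\<phi>. \<phi> \<in> \<Delta> \<Longrightarrow> good \<phi> (\<Theta> \<phi>) (n \<phi>)" by metis
  have "\<exists>zss I F. uniform_definition L M [x] ys \<Delta> 1 zss I F"
  \<comment> \<open>One \<Theta> and one \<open>n\<close> must serve all of \<Delta>. Uniting the
    sets only refines the types, and the sum is a convenient upper bound of all
    \<open>n \<phi>\<close>.\<close>
  proof (rule one_parameter_definition[OF assms(2,3) _ \<Delta>, where \<Theta> = "\<Union> (\<Theta> ` \<Delta>)" and n = "\<Sum>\<phi>\<in>\<Delta>. n \<phi>"])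
    show "linear_on (carrier M) (\<lambda>a b. rint M lt [a, b])"
      by (rule model_linear_on[OF assms(1-5) M])
    show "finite (\<Union> (\<Theta> ` \<Delta>))" using good \<Delta>(2) by (auto simp: good_def)
    show "is_formula L \<theta>" "fvars \<theta> \<subseteq> {x}" if "\<theta> \<in> \<Union> (\<Theta> ` \<Delta>)" for \<theta>
      using good that unfolding good_def by blast+
    fix \<phi> e w a assume \<phi>: "\<phi> \<in> \<Delta>" and e: "e ` set ys \<subseteq> carrier M" "w \<in> carrier M"
    show "\<not> alternation (\<lambda>a b. rint M lt [a, b]) {a \<in> carrier M. same_type M (\<Union> (\<Theta> ` \<Delta>)) w a}
        (?D e \<phi>) (\<Sum>\<phi>\<in>\<Delta>. n \<phi>) a"
    proof
      assume "alternation (\<lambda>a b. rint M lt [a, b]) {a \<in> carrier M. same_type M (\<Union> (\<Theta> ` \<Delta>)) w a}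
        (?D e \<phi>) (\<Sum>\<phi>\<in>\<Delta>. n \<phi>) a"
      moreover have "{a \<in> carrier M. same_type M (\<Union> (\<Theta> ` \<Delta>)) w a} \<subseteq>
          {a \<in> carrier M. same_type M (\<Theta> \<phi>) w a}"
        using \<phi> by (auto simp: same_type_def)
      ultimately have alt: "alternation (\<lambda>a b. rint M lt [a, b]) {a \<in> carrier M. same_type M (\<Theta> \<phi>) w a}
          (?D e \<phi>) (\<Sum>\<phi>\<in>\<Delta>. n \<phi>) a"
        by (rule alternation_mono[rotated])
      have "n \<phi> \<le> (\<Sum>\<phi>\<in>\<Delta>. n \<phi>)"
        using \<phi> \<Delta>(2) by (simp add: member_le_sum)
      from alternation_shorter[OF alt this] obtain b where "alternation (\<lambda>a b. rint M lt [a, b])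
          {a \<in> carrier M. same_type M (\<Theta> \<phi>) w a} (?D e \<phi>) (n \<phi>) b"
        by blast
      with good[OF \<phi>] e show False unfolding good_def by blast
    qed
  qed
  then show "\<exists>zss I F. uniform_definition L M xs ys \<Delta> 1 zss I F" by (simp add: xs)
qed

end
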